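(* Let $\mathcal{A}=\{A_i\}_{i=0}^p$ be a set of $n\times n$ matrices, and let $\mathcal{B}=\{B_i\}_{i=0}^q$ be a set of $n\times n$ matrices with $\operatorname{span}\{B_0,\dots,B_q\}=\operatorname{span}\{A_0,\dots,A_p\}$. Let $P_{\mathcal{B}}(\lambda)=\sum_{i=0}^q\lambda^iB_i$. If $P_{\mathcal{B}}(\lambda)$ has $n$ eigenpairs $(\lambda_j,x_j)$, $j=1,\dots,n$, such that $X=[x_1,\dots,x_n]$ is nonsingular and the geometric multiplicities of $\lambda_1,\dots,\lambda_n$ all equal one, then all solutions to the GJBD problem of $\mathcal{A}$ are equivalent.
   Context: $\operatorname{span}\{A_0,\dots,A_p\}=\{\sum_i\alpha_iA_i:\alpha_i\in\mathbb{C}\}$. A partition of $n$ is a tuple $\tau_n=(n_1,\dots,n_t)$ of positive integers with sum $n$; $\operatorname{card}(\tau_n)=t$. For an $n\times n$ matrix $A$ partitioned into blocks $A_{jk}$ of size $n_j\times n_k$, $A$ is $\tau_n$-block diagonal if $A_{jk}=0$ for $j\ne k$; $\mathbb{D}_{\tau_n}$ is the set of such matrices. The matrices lie in one of $\{$real symmetric, complex Hermitian, $\mathbb{R}^{n\times n}$, $\mathbb{C}^{n\times n}\}$ and diagonalizers are sought in a class $\mathbb{W}_n\in\{$real orthogonal, unitary, real nonsingular, complex nonsingular$\}$; $(\cdot)^\star$ is transpose (real) or conjugate transpose (complex). The JBD problem of a matrix set for a partition $\tau_n$: find $W\in\mathbb{W}_n$ with $W^\star A_iW\in\mathbb{D}_{\tau_n}$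 for all $i$. A solution of the GJBD problem is a pair $(\tau_n,W)$ with $W$ solving the JBD problem for $\tau_n$ and $\operatorname{card}(\tau_n)$ maximal among partitions for which the JBD problem is solvable. For a $t\times t$ permutation matrix $\Pi_t$, $\tau_n\Pi_t$ denotes the correspondingly permuted partition (viewing $\tau_n$ as a row vector), and the block permutation matrix corresponding with $\Pi_t$ is the $n\times n$ matrix obtained by replacing, in the $i$th row of $\Pi_t$, the entry $1$ by a permutation matrix of order $n_i$ and the entries $0$ by zero matrices of appropriate sizes. Two solutions $(\tau_n,W)$, $(\hat\tau_n,\widehat W)$ are equivalent if there exist a $t\times t$ permutation matrix $\Pi_t$ and a nonsingular $D\in\mathbb{D}_{\tau_n}$ such that $(\hat\tau_n,\widehat W)=(\tau_n\Pi_t,WD\Pi)$, where $\Pi$ is the block permutation matrix corresponding with $\Pi_t$. Eigenpairs $(\lambda,x)$ of $P(\lambda)$: $\det P(\lambda)=0$, $x\ne0$, $P(\lambda)x=0$; geometric multiplicity of $\lambda$ is $\dim\ker P(\lambda)$. *)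

theory Defs
  imports "Jordan_Normal_Form.Matrix_Kernel" "Jordan_Normal_Form.Determinant"
          "HOL-Combinatorics.Permutations"
begin

text \<open>All matrices are represented as complex n x n matrices (real ones embedded).\<close>

datatype mat_class = RealSym | Hermitian | RealGen | ComplexGen
datatype diag_class = RealOrth | Unitary | RealNonsing | ComplexNonsing

definition star :: "complex mat \<Rightarrow> complex mat" where
  "star A = transpose_mat (map_mat cnj A)"

definition real_mat :: "complex mat \<Rightarrow> bool" where
  "real_mat A \<longleftrightarrow> (\<forall>k<dim_row A. \<forall>l<dim_col A. Im (A $$ (k,l)) = 0)"

definition in_mat_class :: "mat_class \<Rightarrow> nat \<Rightarrow> complex mat \<Rightarrow> bool" where
  "in_mat_class c n A \<longleftrightarrow> A \<in> carrier_mat n n \<and>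
     (case c of
        RealSym \<Rightarrow> real_mat A \<and> transpose_mat A = A
      | Hermitian \<Rightarrow> star A = A
      | RealGen \<Rightarrow> real_mat A
      | ComplexGen \<Rightarrow> True)"

definition in_diag_class :: "diag_class \<Rightarrow> nat \<Rightarrow> complex mat \<Rightarrow> bool" where
  "in_diag_class c n W \<longleftrightarrow> W \<in> carrier_mat n n \<and>
     (case c of
        RealOrth \<Rightarrow> real_mat W \<and> star W * W = 1\<^sub>m n
      | Unitary \<Rightarrow> star W * W = 1\<^sub>m n
      | RealNonsing \<Rightarrow> real_mat W \<and> det W \<noteq> 0
      | ComplexNonsing \<Rightarrow> det W \<noteq> 0)"

definition is_partition :: "nat \<Rightarrow> nat list \<Rightarrow> bool" where
  "is_partition n \<tau> \<longleftrightarrow> (\<forall>x\<in>set \<tau>. 0 < x) \<and> sum_list \<tau> = n"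

definition blk_off :: "nat list \<Rightarrow> nat \<Rightarrow> nat" where
  "blk_off \<tau> j = sum_list (take j \<tau>)"

definition blk_idx :: "nat list \<Rightarrow> nat \<Rightarrow> nat" where
  "blk_idx \<tau> k = (LEAST j. k < sum_list (take (Suc j) \<tau>))"

definition block_diag :: "nat \<Rightarrow> nat list \<Rightarrow> complex mat \<Rightarrow> bool" where
  "block_diag n \<tau> A \<longleftrightarrow> A \<in> carrier_mat n n \<and>
     (\<forall>k<n. \<forall>l<n. blk_idx \<tau> k \<noteq> blk_idx \<tau> l \<longrightarrow> A $$ (k,l) = 0)"

definition JBD_sol :: "diag_class \<Rightarrow> nat \<Rightarrow> (nat \<Rightarrow> complex mat) \<Rightarrow> nat
    \<Rightarrow> nat list \<Rightarrow> complex mat \<Rightarrow> bool" where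
  "JBD_sol dc n As p \<tau> W \<longleftrightarrow> is_partition n \<tau> \<and> in_diag_class dc n W \<and>
     (\<forall>i\<le>p. block_diag n \<tau> (star W * As i * W))"

definition GJBD_sol :: "diag_class \<Rightarrow> nat \<Rightarrow> (nat \<Rightarrow> complex mat) \<Rightarrow> nat
    \<Rightarrow> nat list \<Rightarrow> complex mat \<Rightarrow> bool" where
  "GJBD_sol dc n As p \<tau> W \<longleftrightarrow> JBD_sol dc n As p \<tau> W \<and>
     (\<forall>\<tau>' W'. JBD_sol dc n As p \<tau>' W' \<longrightarrow> length \<tau>' \<le> length \<tau>)"

text \<open>A t x t permutation matrix Pi_t is given by a permutation sigma of {0..<t}:
  Pi_t(i,j) = 1 iff j = sigma i.  The permuted partition tau Pi_t is tau (row vector) times Pi_t.\<close>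
definition perm_part :: "nat list \<Rightarrow> (nat \<Rightarrow> nat) \<Rightarrow> nat list" where
  "perm_part \<tau> \<sigma> = map (\<lambda>j. \<Sum>i<length \<tau>. \<tau> ! i * (if j = \<sigma> i then 1 else 0)) [0..<length \<tau>]"

text \<open>Block permutation matrix corresponding with Pi_t: row blocks sized by tau, column
  blocks sized by tau Pi_t; block (i, sigma i) is a permutation matrix of order n_i, others zero.\<close>
definition block_perm :: "nat \<Rightarrow> nat list \<Rightarrow> (nat \<Rightarrow> nat) \<Rightarrow> complex mat \<Rightarrow> bool" where
  "block_perm n \<tau> \<sigma> PM \<longleftrightarrow> PM \<in> carrier_mat n n \<and>
     (\<forall>k<n. \<forall>l<n. blk_idx (perm_part \<tau> \<sigma>) l \<noteq> \<sigma> (blk_idx \<tau> k) \<longrightarrow> PM $$ (k,l) = 0) \<and>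
     (\<forall>i<length \<tau>. \<exists>\<rho>. \<rho> permutes {0..<\<tau> ! i} \<and>
        (\<forall>a<\<tau> ! i. \<forall>b<\<tau> ! i.
           PM $$ (blk_off \<tau> i + a, blk_off (perm_part \<tau> \<sigma>) (\<sigma> i) + b) = (if b = \<rho> a then 1 else 0)))"

definition equiv_sol :: "nat \<Rightarrow> nat list \<times> complex mat \<Rightarrow> nat list \<times> complex mat \<Rightarrow> bool" where
  "equiv_sol n s1 s2 \<longleftrightarrow> (case s1 of (\<tau>, W) \<Rightarrow> case s2 of (\<tau>', W') \<Rightarrow>
     (\<exists>\<sigma> D PM. \<sigma> permutes {0..<length \<tau>} \<and> block_diag n \<tau> D \<and> det D \<noteq> 0 \<and>
        block_perm n \<tau> \<sigma> PM \<and> \<tau>' = perm_part \<tau> \<sigma> \<and> W' = W * D * PM))"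

definition lin_comb :: "nat \<Rightarrow> (nat \<Rightarrow> complex mat) \<Rightarrow> nat \<Rightarrow> (nat \<Rightarrow> complex) \<Rightarrow> complex mat" where
  "lin_comb n Ms m \<alpha> = mat n n (\<lambda>(k,l). \<Sum>i\<le>m. \<alpha> i * Ms i $$ (k,l))"

definition span_mats :: "nat \<Rightarrow> (nat \<Rightarrow> complex mat) \<Rightarrow> nat \<Rightarrow> complex mat set" where
  "span_mats n Ms m = {lin_comb n Ms m \<alpha> | \<alpha>. True}"

definition mat_poly :: "nat \<Rightarrow> (nat \<Rightarrow> complex mat) \<Rightarrow> nat \<Rightarrow> complex \<Rightarrow> complex mat" where
  "mat_poly n Bs q z = lin_comb n Bs q (\<lambda>i. z ^ i)"

definition eigenpair :: "nat \<Rightarrow> (complex \<Rightarrow> complex mat) \<Rightarrow> complex \<Rightarrow> complex vec \<Rightarrow> bool" where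
  "eigenpair n P z x \<longleftrightarrow> det (P z) = 0 \<and> x \<in> carrier_vec n \<and> x \<noteq> 0\<^sub>v n \<and> P z *\<^sub>v x = 0\<^sub>v n"

definition geom_mult :: "(complex \<Rightarrow> complex mat) \<Rightarrow> complex \<Rightarrow> nat" where
  "geom_mult P z = kernel_dim (P z)"

end

theory Submission
  imports Defs
begin

text \<open>
  Let \<open>W\<close> block diagonalize all the \<open>A\<^sub>i\<close>, hence also every \<open>P(\<lambda>)\<close>. If \<open>P(\<lambda>\<^sub>j)\<close> has a one-dimensional kernel,
  then \<open>W\<inverse> x\<^sub>j\<close> is supported in a single block, since each of its block components again lies
  in the kernel. So \<open>W\<close> assigns to each \<open>j\<close> a block \<open>s j\<close>, and because \<open>X\<close> is nonsingular the \<open>i\<close>-th block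
  receives exactly \<open>n\<^sub>i\<close> eigenvectors, which span its range.

  A second solution \<open>W'\<close> gives \<open>s'\<close>. The pair \<open>(s, s')\<close> describes a common refinement of the two
  decompositions, whose spectral projectors \<open>X S X\<inverse>\<close> are products of commuting projectors that come from
  \<open>W\<close> and \<open>W'\<close>; they are real or Hermitian when the class of diagonalizers is real or unitary. Hence
  their ranges have bases that form a diagonalizer of the same class, and the refinement
  is again a solution of the JBD problem. By maximality it is not finer than either decomposition, so \<open>s' = \<sigma> \<circ> s\<close>
  for a permutation \<open>\<sigma>\<close> of the blocks, and \<open>W\<inverse> W'\<close> is block diagonal up to a block permutation.
\<close>

section \<open>Blocked matrices\<close>

text \<open>Rows and columns carry separate colorings because the matrices in question change bases:
  in \<open>V * X\<close> the rows are colored by the blocks of a partition, the columns by the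
  blocks to which the eigenvectors belong.\<close>

definition blocked :: "nat \<Rightarrow> (nat \<Rightarrow> 'c) \<Rightarrow> (nat \<Rightarrow> 'c) \<Rightarrow> 'a::zero mat \<Rightarrow> bool" where
  "blocked n r c M \<longleftrightarrow> M \<in> carrier_mat n n \<and> (\<forall>i<n. \<forall>j<n. r i \<noteq> c j \<longrightarrow> M $$ (i,j) = 0)"

text \<open>Coordinate projector of a color. Conjugated by an invertible matrix it projects onto the
  span of the columns of that color, along the remaining columns.\<close>

definition color_proj :: "nat \<Rightarrow> (nat \<Rightarrow> 'c) \<Rightarrow> 'c \<Rightarrow> 'a::semiring_1 mat" where
  "color_proj n c a = mat n n (\<lambda>(i,j). if i = j \<and> c i = a then 1 else 0)"

lemma block_diag_iff_blocked: "block_diag n \<tau> M \<longleftrightarrow> blocked n (blk_idx \<tau>) (blk_idx \<tau>) M"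
  unfolding block_diag_def blocked_def ..

lemma mult_mat_entry:
  assumes "A \<in> carrier_mat n m" "B \<in> carrier_mat m l" "i < n" "j < l"
  shows "(A * B) $$ (i,j) = (\<Sum>k<m. A $$ (i,k) * B $$ (k,j))"
  using assms by (auto simp: scalar_prod_def atLeast0LessThan intro!: sum.cong)

lemma blocked_carrier: "blocked n r c M \<Longrightarrow> M \<in> carrier_mat n n"
  by (simp add: blocked_def)

lemma blocked_mult:
  fixes M N :: "'a::semiring_0 mat"
  assumes M: "blocked n r c M" and N: "blocked n c d N"
  shows "blocked n r d (M * N)"
  unfolding blocked_def
proof (intro conjI allI impI)
  note Mc = blocked_carrier[OF M] and Nc = blocked_carrier[OF N]
  show "M * N \<in> carrier_mat n n"
    using Mc Nc by (rule mult_carrier_mat)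
  fix i j assume ij: "i < n" "j < n" "r i \<noteq> d j"
  have "M $$ (i,k) * N $$ (k,j) = 0" if "k < n" for k
  proof (cases "r i = c k")
    case True
    then show ?thesis using N ij that by (simp add: blocked_def)
  next
    case False
    then show ?thesis using M ij that by (simp add: blocked_def)
  qed
  then show "(M * N) $$ (i,j) = 0"
    unfolding mult_mat_entry[OF Mc Nc ij(1,2)] by simp
qed

section \<open>Conjugate transposes and color projectors\<close>

lemma star_carrier [simp]: "A \<in> carrier_mat m n \<Longrightarrow> star A \<in> carrier_mat n m"
  by (simp add: star_def)

lemma star_entry: "i < dim_col A \<Longrightarrow> j < dim_row A \<Longrightarrow> star A $$ (i,j) = cnj (A $$ (j,i))"
  by (simp add: star_def)

lemma star_mult:
  assumes "A \<in> carrier_mat n m" "B \<in> carrier_mat m l"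
  shows "star (A * B) = star B * star A"
proof (rule eq_matI)
  show "dim_row (star (A * B)) = dim_row (star B * star A)"
    "dim_col (star (A * B)) = dim_col (star B * star A)"
    by (simp_all add: star_def)
  fix i j assume "i < dim_row (star B * star A)" "j < dim_col (star B * star A)"
  then have ij: "i < l" "j < n"
    using assms by (auto simp: star_def)
  then show "star (A * B) $$ (i,j) = (star B * star A) $$ (i,j)"
    using assms
    by (simp add: mult_mat_entry[of _ l m _ n] mult_mat_entry[of _ n m _ l] star_entry mult.commute
        del: index_mult_mat(1))
qed

lemma star_star [simp]: "star (star A) = A"
  by (rule eq_matI) (auto simp: star_def)

lemma blocked_star: "blocked n r c M \<Longrightarrow> blocked n c r (star M)"
  unfolding blocked_def by (auto simp: star_def)

lemma color_proj_carrier [simp]: "color_proj n c a \<in> carrier_mat n n"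
  by (simp add: color_proj_def)

lemma mult_color_proj_entry:
  fixes M :: "'a::semiring_1 mat"
  assumes "M \<in> carrier_mat m n" "i < m" "j < n"
  shows "(M * color_proj n c a) $$ (i,j) = (if c j = a then M $$ (i,j) else 0)"
proof -
  have "(M * color_proj n c a) $$ (i,j) = (\<Sum>k<n. if k = j then (if c j = a then M $$ (i,j) else 0) else 0)"
    unfolding mult_mat_entry[OF assms(1) color_proj_carrier assms(2,3)]
    using assms by (intro sum.cong refl) (auto simp: color_proj_def)
  then show ?thesis using assms by simp
qed

lemma color_proj_mult_entry:
  fixes M :: "'a::semiring_1 mat"
  assumes "M \<in> carrier_mat n m" "i < n" "j < m"
  shows "(color_proj n c a * M) $$ (i,j) = (if c i = a then M $$ (i,j) else 0)"
proof -
  have "(color_proj n c a * M) $$ (i,j) = (\<Sum>k<n. if k = i then (if c i = a then M $$ (i,j) else 0) else 0)"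
    unfolding mult_mat_entry[OF color_proj_carrier assms]
    using assms by (intro sum.cong refl) (auto simp: color_proj_def)
  then show ?thesis using assms by simp
qed

text \<open>A nonzero entry has equal row and column colors, so selecting the rows of color
  \<open>a\<close> and selecting the columns of color \<open>a\<close> keep the same
  entries.\<close>

lemma color_proj_commute:
  fixes M :: "'a::semiring_1 mat"
  assumes "blocked n r c M"
  shows "color_proj n r a * M = M * color_proj n c a"
proof (rule eq_matI)
  have M: "M \<in> carrier_mat n n" using assms by (rule blocked_carrier)
  fix i j assume "i < dim_row (M * color_proj n c a)" "j < dim_col (M * color_proj n c a)"
  then have ij: "i < n" "j < n"
    using M by (auto simp: color_proj_def)
  show "(color_proj n r a * M) $$ (i,j) = (M * color_proj n c a) $$ (i,j)"
    using assms ij unfolding color_proj_mult_entry[OF M ij] mult_color_proj_entry[OF M ij]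
    by (auto simp: blocked_def)
qed (use blocked_carrier[OF assms] in \<open>auto simp: color_proj_def\<close>)

text \<open>Since \<open>M\<close> intertwines the color projectors, its inverse intertwines them in
  the opposite direction. Entry \<open>(i,j)\<close> of this relation, taken for the color
  \<open>r j\<close>, is the claim.\<close>

lemma blocked_inverse:
  fixes M N :: "'a::ring_1 mat"
  assumes M: "blocked n r c M" and N: "N \<in> carrier_mat n n"
    and MN: "M * N = 1\<^sub>m n" and NM: "N * M = 1\<^sub>m n"
  shows "blocked n c r N"
  unfolding blocked_def
proof (intro conjI N allI impI)
  fix i j assume ij: "i < n" "j < n" "c i \<noteq> r j"
  note Mc = blocked_carrier[OF M]
  let ?P = "color_proj n r (r j)" and ?Q = "color_proj n c (r j)"
  have "N * ?P = N * ?P * (M * N)"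
    using N by (simp add: MN right_mult_one_mat[of _ n n])
  also have "\<dots> = N * (?P * M) * N"
    using N Mc by (simp add: assoc_mult_mat[of _ n n _ n _ n] mult_carrier_mat[of _ n n _ n])
  also have "\<dots> = (N * M) * ?Q * N"
    using N Mc by (simp add: color_proj_commute[OF M] assoc_mult_mat[of _ n n _ n _ n]
        mult_carrier_mat[of _ n n _ n])
  finally have "(N * ?P) $$ (i,j) = (?Q * N) $$ (i,j)"
    by (simp add: NM left_mult_one_mat[of _ n n])
  then show "N $$ (i,j) = 0"
    using ij N by (simp add: mult_color_proj_entry[of _ n n] color_proj_mult_entry[of _ n n] del: index_mult_mat(1))
qed

text \<open>Both sides are the trace of the same matrix \<open>color_proj n r a * M * N\<close>.\<close>
lemma card_color_eq:
  fixes M N :: "complex mat"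
  assumes M: "blocked n r c M" and N: "N \<in> carrier_mat n n"
    and MN: "M * N = 1\<^sub>m n" and NM: "N * M = 1\<^sub>m n"
  shows "card {i. i < n \<and> r i = a} = card {j. j < n \<and> c j = a}"
proof -
  note Mc = blocked_carrier[OF M]
  have "of_nat (card {i. i < n \<and> r i = a}) = (\<Sum>i<n. if r i = a then (M * N) $$ (i,i) else 0)"
    by (simp add: MN sum.If_cases Int_def cong: conj_cong)
  also have "\<dots> = (\<Sum>i<n. \<Sum>j<n. if r i = a then M $$ (i,j) * N $$ (j,i) else 0)"
    using N Mc by (intro sum.cong) (auto simp: mult_mat_entry[of _ n n _ n] simp del: index_mult_mat(1))
  also have "\<dots> = (\<Sum>i<n. \<Sum>j<n. if c j = a then N $$ (j,i) * M $$ (i,j) else 0)"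
    using M by (intro sum.cong refl) (auto simp: blocked_def)
  also have "\<dots> = (\<Sum>j<n. \<Sum>i<n. if c j = a then N $$ (j,i) * M $$ (i,j) else 0)"
    by (rule sum.swap)
  also have "\<dots> = (\<Sum>j<n. if c j = a then (N * M) $$ (j,j) else 0)"
    using N Mc by (intro sum.cong) (auto simp: mult_mat_entry[of _ n n _ n] simp del: index_mult_mat(1))
  also have "\<dots> = of_nat (card {j. j < n \<and> c j = a})"
    by (simp add: NM sum.If_cases Int_def cong: conj_cong)
  finally show ?thesis by simp
qed

section \<open>Inverses and one-dimensional kernels\<close>

lemma mat_inverse_exists:
  assumes "A \<in> carrier_mat n n" "det A \<noteq> (0::'a::field)"
  obtains B where "B \<in> carrier_mat n n" "A * B = 1\<^sub>m n" "B * A = 1\<^sub>m n"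
  using det_non_zero_imp_unit[OF assms, of "()"] unfolding Units_def by (auto simp: ring_mat_def)

lemma kernel_dim_one_multiple:
  fixes A :: "'a::field mat"
  assumes A: "A \<in> carrier_mat n n" and dim: "kernel_dim A = 1"
    and u: "u \<in> mat_kernel A" "u \<noteq> 0\<^sub>v n" and v: "v \<in> mat_kernel A"
  obtains k where "v = k \<cdot>\<^sub>v u"
proof -
  interpret kernel n n A by unfold_locales (rule A)
  obtain B where B: "finite B" "basis B"
    using kernel_basis_exists[OF A] by blast
  have "card B = 1"
    using dim Ker.dim_basis[OF B] by simp
  then obtain w where w: "B = {w}"
    by (auto simp: card_1_singleton_iff)
  have sp: "span {w} = mat_kernel A" and wk: "w \<in> mat_kernel A"
    using B unfolding w Ker.basis_def by auto
  have wc: "w \<in> carrier_vec n"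
    using wk mat_kernelD[OF A] by blast
  have mult: "\<exists>k. z = k \<cdot>\<^sub>v w" if "z \<in> mat_kernel A" for z
  proof -
    from that sp have "z \<in> NC.span {w}"
      using span_same[of "{w}"] wk by auto
    then obtain a where "z = NC.lincomb a {w}"
      using NC.finite_in_span[of "{w}" z] wc by auto
    then show ?thesis
      using wc by (auto simp: NC.lincomb_def NC.M.finsum_insert)
  qed
  obtain a b where ab: "u = a \<cdot>\<^sub>v w" "v = b \<cdot>\<^sub>v w"
    using mult u v by blast
  have "a \<noteq> 0"
    using u(2) ab(1) wc by auto
  then have "v = (b / a) \<cdot>\<^sub>v u"
    unfolding ab using wc by (simp add: smult_smult_assoc)
  then show thesis by (rule that)
qed

section \<open>Bases adapted to a family of projectors\<close>

text \<open>The determinant is multilinear in the rows, and each row is the sum of its restrictions to the colors.\<close>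
lemma exists_mask_det_nonzero:
  fixes M :: "'a::comm_ring_1 mat" and s :: "nat \<Rightarrow> nat"
  assumes M: "M \<in> carrier_mat n n" and det: "det M \<noteq> 0"
  obtains c where "det (mat n n (\<lambda>(i,j). if s j = c i then M $$ (i,j) else 0)) \<noteq> 0"
proof -
  define S where "S = s ` {..<n}"
  define a where "a i f = vec n (\<lambda>j. if s j = f then M $$ (i,j) else 0)" for i f
  have S: "finite S" by (simp add: S_def)
  have a: "a \<in> {0..<n} \<rightarrow> S \<rightarrow> carrier_vec n" by (simp add: a_def)
  have M_eq: "M = mat\<^sub>r n n (\<lambda>i. finsum_vec TYPE('a) n (a i) S)"
  proof (rule eq_matI)
    fix i j assume "i < dim_row (mat\<^sub>r n n (\<lambda>i. finsum_vec TYPE('a) n (a i) S))"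
      "j < dim_col (mat\<^sub>r n n (\<lambda>i. finsum_vec TYPE('a) n (a i) S))"
    then have ij: "i < n" "j < n" by auto
    have "(\<Sum>f\<in>S. a i f $ j) = (\<Sum>f\<in>S. if f = s j then M $$ (i,j) else 0)"
      using ij by (intro sum.cong) (auto simp: a_def)
    also have "\<dots> = M $$ (i,j)"
      using ij S by (simp add: S_def)
    finally show "M $$ (i,j) = mat\<^sub>r n n (\<lambda>i. finsum_vec TYPE('a) n (a i) S) $$ (i,j)"
      using ij index_finsum_vec[OF S ij(2), of "a i"] by (simp add: a_def)
  qed (use M in auto)
  have det_M: "det M = sum (\<lambda>f. det (mat\<^sub>r n n (\<lambda>i. a i (f i))))
      {f. (\<forall>i\<in>{0..<n}. f i \<in> S) \<and> (\<forall>i. i \<notin> {0..<n} \<longrightarrow> f i = i)}"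
    by (subst M_eq) (rule det_linear_rows_sum[OF S a])
  have "\<exists>c. det (mat\<^sub>r n n (\<lambda>i. a i (c i))) \<noteq> 0"
  proof (rule ccontr)
    assume "\<not> ?thesis"
    then have "det M = 0" unfolding det_M by (intro sum.neutral) blast
    with det show False by simp
  qed
  then obtain c where "det (mat\<^sub>r n n (\<lambda>i. a i (c i))) \<noteq> 0" ..
  moreover have "mat\<^sub>r n n (\<lambda>i. a i (c i)) = mat n n (\<lambda>(i,j). if s j = c i then M $$ (i,j) else 0)"
    by (rule eq_matI) (auto simp: a_def)
  finally show thesis by (rule that)
qed

lemma sandwich_color_proj_entry:
  fixes M N :: "'a::semiring_1 mat"
  assumes M: "M \<in> carrier_mat m n" and N: "N \<in> carrier_mat n l" and ij: "i < m" "j < l"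
  shows "(M * color_proj n c a * N) $$ (i,j) = (\<Sum>k<n. if c k = a then M $$ (i,k) * N $$ (k,j) else 0)"
  unfolding mult_mat_entry[OF mult_carrier_mat[OF M color_proj_carrier] N ij]
  using M ij by (intro sum.cong) (auto simp: mult_color_proj_entry[OF M] simp del: index_mult_mat(1))

text \<open>Column \<open>l\<close> of \<open>W\<close> is the \<open>l\<close>-th column of the
  projector for color \<open>c l\<close>; in the basis \<open>X\<close> it is the
  \<open>l\<close>-th column of \<open>Y\<close> masked to that color. Describing \<open>W\<close>
  through the projectors lets realness pass from them to \<open>W\<close> even if \<open>X\<close>
  is complex.\<close>

lemma exists_adapted_nonsingular:
  fixes X Y :: "complex mat" and s :: "nat \<Rightarrow> nat"
  assumes X: "X \<in> carrier_mat n n" and Y: "Y \<in> carrier_mat n n"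
    and XY: "X * Y = 1\<^sub>m n" and YX: "Y * X = 1\<^sub>m n"
  obtains W c where "W \<in> carrier_mat n n" "det W \<noteq> 0" "blocked n s c (Y * W)"
    "\<And>k l. k < n \<Longrightarrow> l < n \<Longrightarrow> W $$ (k,l) = (X * color_proj n s (c l) * Y) $$ (k,l)"
proof -
  have dX: "det X \<noteq> 0" and dY: "det Y \<noteq> 0"
    using det_mult[OF X Y] XY by auto
  \<comment> \<open>The determinant expansion chooses one color per row, whereas here each column of
    \<open>Y\<close> needs one; hence the transpose.\<close>
  then have "det (transpose_mat Y) \<noteq> 0"
    using Y by (simp add: det_transpose)
  then obtain c where c: "det (mat n n (\<lambda>(i,j). if s j = c i then transpose_mat Y $$ (i,j) else 0)) \<noteq> 0"
    using exists_mask_det_nonzero[of "transpose_mat Y" n s] Y by auto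
  define U where "U = mat n n (\<lambda>(j,l). if s j = c l then Y $$ (j,l) else 0)"
  have U: "U \<in> carrier_mat n n" by (simp add: U_def)
  have "transpose_mat U = mat n n (\<lambda>(i,j). if s j = c i then transpose_mat Y $$ (i,j) else 0)"
    using Y by (intro eq_matI) (auto simp: U_def)
  with c U have dU: "det U \<noteq> 0"
    by (metis det_transpose)
  show thesis
  proof (rule that[of "X * U" c])
    show "X * U \<in> carrier_mat n n" using X U by simp
    show "det (X * U) \<noteq> 0" using dX dU by (simp add: det_mult[OF X U])
    have "Y * (X * U) = U"
      using X Y U YX assoc_mult_mat[OF Y X U] by simp
    then show "blocked n s c (Y * (X * U))"
      by (simp add: blocked_def U_def)
    fix k l assume kl: "k < n" "l < n"
    have "(X * color_proj n s (c l) * Y) $$ (k,l)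
        = (\<Sum>j<n. X $$ (k,j) * U $$ (j,l))"
      unfolding sandwich_color_proj_entry[OF X Y kl] using kl by (intro sum.cong) (auto simp: U_def)
    then show "(X * U) $$ (k,l) = (X * color_proj n s (c l) * Y) $$ (k,l)"
      by (simp add: mult_mat_entry[OF X U kl])
  qed
qed

text \<open>Gram--Schmidt inside the ranges of the projectors \<open>h a\<close>: \<open>w a m\<close> below is \<open>h a\<close> applied to the \<open>m\<close>-th
  unit vector, made orthogonal to the earlier vectors. Not all \<open>w a m\<close> vanish: otherwise the identity
  would be the orthogonal projector onto the span of \<open>k < n\<close> vectors, contradicting its trace.\<close>
lemma exists_orthonormal_adapted_family:
  fixes h :: "'c \<Rightarrow> nat \<Rightarrow> nat \<Rightarrow> complex"
  assumes S: "finite S"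
    and idem: "\<And>a b i j. a \<in> S \<Longrightarrow> b \<in> S \<Longrightarrow> i < n \<Longrightarrow> j < n \<Longrightarrow>
        (\<Sum>m<n. h a i m * h b m j) = (if a = b then h a i j else 0)"
    and herm: "\<And>a i j. a \<in> S \<Longrightarrow> i < n \<Longrightarrow> j < n \<Longrightarrow> cnj (h a i j) = h a j i"
    and total: "\<And>i. i < n \<Longrightarrow> (\<Sum>a\<in>S. h a i i) = 1"
  shows "k \<le> n \<Longrightarrow> \<exists>v c. (\<forall>l<k. c l \<in> S)
    \<and> (\<forall>l<k. \<forall>a\<in>S. \<forall>i<n. (\<Sum>m<n. h a i m * v l m) = (if a = c l then v l i else 0))
    \<and> (\<forall>i<k. \<forall>j<k. (\<Sum>m<n. cnj (v i m) * v j m) = (if i = j then 1 else 0))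
    \<and> ((\<forall>a\<in>S. \<forall>i<n. \<forall>j<n. h a i j \<in> \<real>) \<longrightarrow> (\<forall>l<k. \<forall>m<n. v l m \<in> \<real>))"
proof (induction k)
  case 0
  show ?case by simp
next
  case (Suc k)
  then have "k \<le> n" by simp
  from Suc.IH[OF this] obtain v c where cS: "\<forall>l<k. c l \<in> S"
    and ev: "\<forall>l<k. \<forall>a\<in>S. \<forall>i<n. (\<Sum>m<n. h a i m * v l m) = (if a = c l then v l i else 0)"
    and on: "\<forall>i<k. \<forall>j<k. (\<Sum>m<n. cnj (v i m) * v j m) = (if i = j then 1 else 0)"
    and re: "(\<forall>a\<in>S. \<forall>i<n. \<forall>j<n. h a i j \<in> \<real>) \<longrightarrow> (\<forall>l<k. \<forall>m<n. v l m \<in> \<real>)"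
    by blast
  note cS = cS[rule_format] and ev = ev[rule_format] and on = on[rule_format] and re = mp[OF re]
  \<comment> \<open>Only the earlier vectors of color \<open>a\<close> are subtracted: the others
    are annihilated by the Hermitian \<open>h a\<close>, hence already orthogonal to its
    range.\<close>
  define w where "w a m r = h a r m - (\<Sum>i<k. if c i = a then cnj (v i m) * v i r else 0)" for a m r
  have "\<exists>a\<in>S. \<exists>m<n. \<exists>r<n. w a m r \<noteq> 0"
  proof (rule ccontr)
    assume "\<not> ?thesis"
    then have w0: "w a m m = 0" if "a \<in> S" "m < n" for a m
      using that by blast
    have "0 = (\<Sum>m<n. \<Sum>a\<in>S. w a m m)"
      using w0 by simp
    also have "\<dots> = (\<Sum>m<n. 1 - (\<Sum>i<k. cnj (v i m) * v i m))"
    proof (intro sum.cong refl)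
      fix m assume "m \<in> {..<n}"
      have "(\<Sum>a\<in>S. \<Sum>i<k. if c i = a then cnj (v i m) * v i m else 0)
          = (\<Sum>i<k. \<Sum>a\<in>S. if c i = a then cnj (v i m) * v i m else 0)"
        by (rule sum.swap)
      also have "\<dots> = (\<Sum>i<k. cnj (v i m) * v i m)"
        using S cS by (intro sum.cong) auto
      finally show "(\<Sum>a\<in>S. w a m m) = 1 - (\<Sum>i<k. cnj (v i m) * v i m)"
        using total \<open>m \<in> {..<n}\<close> by (simp add: w_def sum_subtractf)
    qed
    also have "\<dots> = of_nat n - (\<Sum>i<k. \<Sum>m<n. cnj (v i m) * v i m)"
      by (simp add: sum_subtractf sum.swap[of _ "{..<k}"])
    also have "\<dots> = of_nat n - of_nat k"
      using on by simp
    finally show False using Suc.prems by simp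
  qed
  then obtain a m r where am: "a \<in> S" "m < n" "r < n" "w a m r \<noteq> 0"
    by blast
  define u where "u = w a m"
  \<comment> \<open>Both the column of \<open>h a\<close> and the subtracted vectors lie in the
    range of \<open>h a\<close>, so \<open>h a\<close> fixes \<open>u\<close> and the other
    projectors kill it.\<close>
  have ue: "(\<Sum>j<n. h b i j * u j) = (if b = a then u i else 0)" if "b \<in> S" "i < n" for b i
  proof -
    have "(\<Sum>j<n. h b i j * u j) = (\<Sum>j<n. h b i j * h a j m)
        - (\<Sum>j<n. \<Sum>l<k. if c l = a then cnj (v l m) * (h b i j * v l j) else 0)"
      by (simp add: u_def w_def right_diff_distrib sum_subtractf sum_distrib_left if_distrib mult_ac cong: if_cong)
    also have "(\<Sum>j<n. \<Sum>l<k. if c l = a then cnj (v l m) * (h b i j * v l j) else 0)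
        = (\<Sum>l<k. \<Sum>j<n. if c l = a then cnj (v l m) * (h b i j * v l j) else 0)"
      by (rule sum.swap)
    also have "\<dots> = (\<Sum>l<k. if c l = a then cnj (v l m) * (\<Sum>j<n. h b i j * v l j) else 0)"
      by (intro sum.cong) (auto simp: sum_distrib_left)
    also have "\<dots> = (\<Sum>l<k. if c l = a then cnj (v l m) * (if b = a then v l i else 0) else 0)"
      using ev that by (intro sum.cong) auto
    also have "(\<Sum>j<n. h b i j * h a j m) = (if b = a then h a i m else 0)"
      using idem[OF that(1) am(1) that(2) am(2)] by simp
    finally show ?thesis
      by (cases "b = a") (simp_all add: u_def w_def cong: if_cong)
  qed
  have uo: "(\<Sum>j<n. cnj (v l j) * u j) = 0" if "l < k" for l
  proof -
    have "(\<Sum>j<n. cnj (v l j) * u j) = (\<Sum>j<n. cnj (v l j) * h a j m)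
        - (\<Sum>j<n. \<Sum>i<k. if c i = a then cnj (v i m) * (cnj (v l j) * v i j) else 0)"
      by (simp add: u_def w_def right_diff_distrib sum_subtractf sum_distrib_left if_distrib mult_ac cong: if_cong)
    also have "(\<Sum>j<n. \<Sum>i<k. if c i = a then cnj (v i m) * (cnj (v l j) * v i j) else 0)
        = (\<Sum>i<k. \<Sum>j<n. if c i = a then cnj (v i m) * (cnj (v l j) * v i j) else 0)"
      by (rule sum.swap)
    also have "\<dots> = (\<Sum>i<k. if c i = a then cnj (v i m) * (\<Sum>j<n. cnj (v l j) * v i j) else 0)"
      by (intro sum.cong) (auto simp: sum_distrib_left)
    also have "\<dots> = (\<Sum>i<k. if i = l then (if c l = a then cnj (v l m) else 0) else 0)"
      using on that by (intro sum.cong) auto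
    also have "(\<Sum>j<n. cnj (v l j) * h a j m) = cnj (\<Sum>j<n. h a m j * v l j)"
      using herm am by (simp add: mult.commute)
    also have "\<dots> = (if c l = a then cnj (v l m) else 0)"
      using ev[OF that am(1,2)] by simp
    finally show ?thesis using that by simp
  qed
  have uo': "(\<Sum>j<n. cnj (u j) * v l j) = 0" if "l < k" for l
    using arg_cong[OF uo[OF that], of cnj] by (simp add: mult.commute)
  define N where "N = (\<Sum>j<n. (cmod (u j))\<^sup>2)"
  have "0 < (cmod (u r))\<^sup>2" using am by (simp add: u_def)
  also have "\<dots> \<le> N" unfolding N_def using am by (intro member_le_sum) auto
  finally have N: "N > 0" .
  have uu: "(\<Sum>j<n. cnj (u j) * u j) = of_real N"
    by (simp add: N_def complex_norm_square mult.commute del: of_real_power)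
  \<comment> \<open>The norm of \<open>u\<close>, kept as a real number so that normalizing
    preserves real vectors.\<close>
  define q where "q = complex_of_real (sqrt N)"
  have q: "q \<noteq> 0" "cnj q = q" "q * q = of_real N" "q \<in> \<real>"
    using N by (auto simp: q_def simp flip: of_real_mult)
  define v' where "v' = v(k := \<lambda>j. u j / q)"
  define c' where "c' = c(k := a)"
  show ?case
  proof (intro exI[of _ v'] exI[of _ c'] conjI allI impI ballI)
    show "c' l \<in> S" if "l < Suc k" for l
      using cS am that by (auto simp: c'_def less_Suc_eq)
    show "(\<Sum>m<n. h b i m * v' l m) = (if b = c' l then v' l i else 0)"
      if "l < Suc k" "b \<in> S" "i < n" for l b i
      using that ev ue by (auto simp: v'_def c'_def less_Suc_eq simp flip: sum_divide_distrib)
    show "(\<Sum>m<n. cnj (v' i m) * v' j m) = (if i = j then 1 else 0)"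
      if "i < Suc k" "j < Suc k" for i j
      using that on uo uo' uu q
      by (auto simp: v'_def less_Suc_eq simp flip: sum_divide_distrib)
    show "v' l i \<in> \<real>" if "\<forall>a\<in>S. \<forall>i<n. \<forall>j<n. h a i j \<in> \<real>" "l < Suc k" "i < n" for l i
    proof (cases "l = k")
      case True
      have "(if c l = a then cnj (v l m) * v l i else 0) \<in> \<real>" if "l < k" for l
        using re that am \<open>i < n\<close> \<open>\<forall>a\<in>S. \<forall>i<n. \<forall>j<n. h a i j \<in> \<real>\<close> by (auto intro!: Reals_mult simp: Reals_cnj_iff)
      then have "u i \<in> \<real>"
        unfolding u_def w_def using that am by (auto intro!: Reals_diff sum_in_Reals)
      then show ?thesis using True q by (simp add: v'_def Reals_divide)
    next
      case False
      then show ?thesis using re that by (simp add: v'_def)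
    qed
  qed
qed

lemma color_proj_mult:
  "color_proj n c a * color_proj n c b = (if a = b then color_proj n c a else (0\<^sub>m n n :: 'a::semiring_1 mat))"
proof (rule eq_matI)
  fix i j assume "i < dim_row (if a = b then color_proj n c a else (0\<^sub>m n n :: 'a mat))"
    "j < dim_col (if a = b then color_proj n c a else (0\<^sub>m n n :: 'a mat))"
  then have ij: "i < n" "j < n"
    by (auto simp: color_proj_def split: if_splits)
  then show "(color_proj n c a * color_proj n c b) $$ (i,j)
      = (if a = b then color_proj n c a else (0\<^sub>m n n :: 'a mat)) $$ (i,j)"
    unfolding color_proj_mult_entry[OF color_proj_carrier ij] by (auto simp: color_proj_def)
qed (auto simp: color_proj_def)

text \<open>The Hermitian projectors \<open>H a\<close> have mutually orthogonal ranges that fill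
  the space, so orthonormal bases of the ranges combine to a unitary \<open>W\<close>. It is real
  whenever the projectors are, even if \<open>X\<close> is not.\<close>

lemma exists_adapted_unitary:
  fixes X Y :: "complex mat" and s :: "nat \<Rightarrow> 'c" and n :: nat
  defines "H \<equiv> \<lambda>a. X * color_proj n s a * Y"
  assumes X: "X \<in> carrier_mat n n" and Y: "Y \<in> carrier_mat n n"
    and XY: "X * Y = 1\<^sub>m n" and YX: "Y * X = 1\<^sub>m n"
    and herm: "\<And>a. star (H a) = H a"
  obtains W c where "W \<in> carrier_mat n n" "star W * W = 1\<^sub>m n" "blocked n s c (Y * W)"
    "(\<forall>a. real_mat (H a)) \<Longrightarrow> real_mat W"
proof -
  define S where "S = s ` {..<n}"
  have H: "H a \<in> carrier_mat n n" for a
    using X Y by (auto simp: H_def intro!: mult_carrier_mat)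
  have idem: "(\<Sum>m<n. H a $$ (i,m) * H b $$ (m,j)) = (if a = b then H a $$ (i,j) else 0)"
    if "i < n" "j < n" for a b i j
  proof -
    have "H a * H b = X * (color_proj n s a * (Y * X) * color_proj n s b) * Y"
      unfolding H_def using X Y
      by (simp add: assoc_mult_mat[of _ n n _ n _ n] mult_carrier_mat[of _ n n _ n] del: YX)
    then have "H a * H b = (if a = b then H a else 0\<^sub>m n n)"
      using X Y by (auto simp: YX H_def right_mult_one_mat[of _ n n] color_proj_mult)
    then show ?thesis
      using that mult_mat_entry[OF H H that, of a b] by (auto split: if_splits)
  qed
  have total: "(\<Sum>a\<in>S. H a $$ (i,i)) = 1" if "i < n" for i
  proof -
    have "(\<Sum>a\<in>S. H a $$ (i,i)) = (\<Sum>a\<in>S. \<Sum>j<n. if s j = a then X $$ (i,j) * Y $$ (j,i) else 0)"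
      unfolding H_def sandwich_color_proj_entry[OF X Y that that] ..
    also have "\<dots> = (\<Sum>j<n. \<Sum>a\<in>S. if s j = a then X $$ (i,j) * Y $$ (j,i) else 0)"
      by (rule sum.swap)
    also have "\<dots> = (\<Sum>j<n. X $$ (i,j) * Y $$ (j,i))"
      by (intro sum.cong) (auto simp: S_def)
    also have "\<dots> = (X * Y) $$ (i,i)"
      using mult_mat_entry[OF X Y that that] by simp
    finally show ?thesis using that by (simp add: XY)
  qed
  have "cnj (H a $$ (i,j)) = H a $$ (j,i)" if "i < n" "j < n" for a i j
    using H[of a] that star_entry[of j "H a" i] by (simp add: herm)
  note hermitian = this
  have "finite S" by (simp add: S_def)
  from exists_orthonormal_adapted_family[of S n "\<lambda>a i j. H a $$ (i,j)" n, OF this idem hermitian total order_refl]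
  obtain v c where cS: "\<forall>l<n. c l \<in> S"
    and ev: "\<forall>l<n. \<forall>a\<in>S. \<forall>i<n. (\<Sum>m<n. H a $$ (i,m) * v l m) = (if a = c l then v l i else 0)"
    and on: "\<forall>i<n. \<forall>j<n. (\<Sum>m<n. cnj (v i m) * v j m) = (if i = j then 1 else 0)"
    and re: "(\<forall>a\<in>S. \<forall>i<n. \<forall>j<n. H a $$ (i,j) \<in> \<real>) \<longrightarrow> (\<forall>l<n. \<forall>m<n. v l m \<in> \<real>)"
    by blast
  note cS = cS[rule_format] and ev = ev[rule_format] and on = on[rule_format] and re = mp[OF re]
  define W where "W = mat n n (\<lambda>(i,l). v l i)"
  have W: "W \<in> carrier_mat n n" by (simp add: W_def)
  show thesis
  proof (rule that[of W c])
    show "star W * W = 1\<^sub>m n"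
    proof (rule eq_matI)
      fix i j assume "i < dim_row (1\<^sub>m n :: complex mat)" "j < dim_col (1\<^sub>m n :: complex mat)"
      then have ij: "i < n" "j < n" by auto
      show "(star W * W) $$ (i,j) = 1\<^sub>m n $$ (i,j)"
        unfolding mult_mat_entry[OF star_carrier[OF W] W ij]
      proof -
        have "(\<Sum>k<n. star W $$ (i,k) * W $$ (k,j)) = (\<Sum>m<n. cnj (v i m) * v j m)"
          using ij by (intro sum.cong) (simp_all add: star_def W_def)
        then show "(\<Sum>k<n. star W $$ (i,k) * W $$ (k,j)) = 1\<^sub>m n $$ (i,j)"
          using on[OF ij] ij by simp
      qed
    qed (use W in \<open>auto simp: star_def\<close>)
    show "blocked n s c (Y * W)"
      unfolding blocked_def
    proof (intro conjI allI impI)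
      fix i l assume il: "i < n" "l < n" "s i \<noteq> c l"
      \<comment> \<open>In the basis \<open>X\<close> the projector \<open>H (c l)\<close> becomes a
        coordinate projector, so a column fixed by it has coordinates of color \<open>c l\<close>
        only.\<close>
      have YH: "Y * H (c l) = color_proj n s (c l) * Y"
        unfolding H_def using X Y YX
        by (simp add: assoc_mult_mat[of Y n n _ n _ n, symmetric] mult_carrier_mat[of _ n n _ n] left_mult_one_mat[of _ n n])
      have "(H (c l) * W) $$ (k,l) = W $$ (k,l)" if "k < n" for k
        using that il H W ev[OF il(2) cS[OF il(2)] that] by (simp add: mult_mat_entry[of _ n n _ n] W_def del: index_mult_mat(1))
      moreover have HW: "H (c l) * W \<in> carrier_mat n n"
        using H W by (rule mult_carrier_mat)
      ultimately have "(Y * W) $$ (i,l) = (Y * (H (c l) * W)) $$ (i,l)"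
        unfolding mult_mat_entry[OF Y W il(1,2)] mult_mat_entry[OF Y HW il(1,2)] by simp
      also have "Y * (H (c l) * W) = color_proj n s (c l) * (Y * W)"
        using assoc_mult_mat[OF Y H W, of "c l"] assoc_mult_mat[OF color_proj_carrier Y W] YH by metis
      finally have "(Y * W) $$ (i,l) = (color_proj n s (c l) * (Y * W)) $$ (i,l)" .
      then show "(Y * W) $$ (i,l) = 0"
        using il Y W by (simp add: color_proj_mult_entry[of _ n n] del: index_mult_mat(1))
    qed (use Y W in simp)
    show "real_mat W" if "\<forall>a. real_mat (H a)"
    proof -
      have "\<forall>a\<in>S. \<forall>i<n. \<forall>j<n. H a $$ (i,j) \<in> \<real>"
        using that carrier_matD[OF H] by (simp add: real_mat_def complex_is_Real_iff)
      from re[OF this] show ?thesis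
        by (simp add: real_mat_def W_def complex_is_Real_iff)
    qed
  qed (rule W)
qed

section \<open>Block indices and equivalence of solutions\<close>

lemma blk_off_Suc: "j < length \<tau> \<Longrightarrow> blk_off \<tau> (Suc j) = blk_off \<tau> j + \<tau> ! j"
  by (simp add: blk_off_def take_Suc_conv_app_nth)

lemma blk_off_mono: "i \<le> j \<Longrightarrow> blk_off \<tau> i \<le> blk_off \<tau> j"
proof (induction rule: dec_induct)
  case (step j)
  then show ?case
    by (cases "j < length \<tau>") (auto simp: blk_off_Suc, auto simp: blk_off_def)
qed simp

lemma blk_off_le_sum_list: "blk_off \<tau> j \<le> sum_list \<tau>"
  using blk_off_mono[of j "max j (length \<tau>)" \<tau>] by (simp add: blk_off_def)

lemma blk_idx_eq: "blk_idx \<tau> k = (LEAST j. k < blk_off \<tau> (Suc j))"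
  by (simp add: blk_idx_def blk_off_def)

lemma blk_idx_offset:
  assumes "j < length \<tau>" "a < \<tau> ! j"
  shows "blk_idx \<tau> (blk_off \<tau> j + a) = j"
  unfolding blk_idx_eq
proof (rule Least_equality)
  show "blk_off \<tau> j + a < blk_off \<tau> (Suc j)"
    using assms by (simp add: blk_off_Suc)
  fix y assume y: "blk_off \<tau> j + a < blk_off \<tau> (Suc y)"
  show "j \<le> y"
  proof (rule ccontr)
    assume "\<not> j \<le> y"
    then have "blk_off \<tau> (Suc y) \<le> blk_off \<tau> j" by (intro blk_off_mono) simp
    with y show False by simp
  qed
qed

lemma blk_idx_decomp:
  assumes "k < sum_list \<tau>"
  shows "blk_idx \<tau> k < length \<tau>" "blk_off \<tau> (blk_idx \<tau> k) \<le> k"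
    "k - blk_off \<tau> (blk_idx \<tau> k) < \<tau> ! blk_idx \<tau> k"
proof -
  define j where "j = blk_idx \<tau> k"
  \<comment> \<open>Witness that the \<open>LEAST\<close> is attained: taking more entries than
    \<open>\<tau>\<close> has yields the full sum.\<close>
  have "k < blk_off \<tau> (Suc (length \<tau>))"
    using assms by (simp add: blk_off_def)
  then have kj: "k < blk_off \<tau> (Suc j)"
    unfolding j_def blk_idx_eq by (rule LeastI)
  have le: "blk_off \<tau> j \<le> k"
  proof (cases j)
    case (Suc i)
    then show ?thesis
      using not_less_Least[of i "\<lambda>j. k < blk_off \<tau> (Suc j)"] by (simp add: j_def blk_idx_eq)
  qed (simp add: blk_off_def)
  have "j < length \<tau>"
  proof (rule ccontr)
    assume "\<not> j < length \<tau>"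
    then have "blk_off \<tau> (Suc j) = blk_off \<tau> j" by (simp add: blk_off_def)
    with kj le show False by simp
  qed
  with kj le show "blk_idx \<tau> k < length \<tau>" "blk_off \<tau> (blk_idx \<tau> k) \<le> k"
    "k - blk_off \<tau> (blk_idx \<tau> k) < \<tau> ! blk_idx \<tau> k"
    unfolding j_def[symmetric] by (auto simp: blk_off_Suc)
qed

lemma blk_off_add_less:
  assumes "j < length \<tau>" "a < \<tau> ! j"
  shows "blk_off \<tau> j + a < sum_list \<tau>"
  using assms blk_off_le_sum_list[of \<tau> "Suc j"] by (simp add: blk_off_Suc)

lemma card_blk_idx:
  assumes "j < length \<tau>"
  shows "card {k. k < sum_list \<tau> \<and> blk_idx \<tau> k = j} = \<tau> ! j"
proof -
  have "{k. k < sum_list \<tau> \<and> blk_idx \<tau> k = j} = (\<lambda>a. blk_off \<tau> j + a) ` {..<\<tau> ! j}" (is "?A = ?B")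
  proof
    show "?A \<subseteq> ?B"
    proof
      fix k assume "k \<in> ?A"
      then have "k < sum_list \<tau>" "j = blk_idx \<tau> k" by auto
      with blk_idx_decomp[of k \<tau>] show "k \<in> ?B"
        by (intro image_eqI[of _ _ "k - blk_off \<tau> j"]) auto
    qed
    show "?B \<subseteq> ?A"
      using assms by (auto simp: blk_idx_offset blk_off_add_less)
  qed
  then show ?thesis by (simp add: card_image)
qed

text \<open>Makes an arbitrary coloring contiguous: the block sizes are the fiber sizes, positive by
  surjectivity, and \<open>\<pi>\<close> sorts the coordinates by color.\<close>

lemma exists_sorting_partition:
  fixes c :: "nat \<Rightarrow> nat"
  assumes surj: "c ` {..<n} = {..<m}"
  obtains \<tau> \<pi> where "is_partition n \<tau>" "length \<tau> = m" "\<pi> permutes {..<n}"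
    "\<And>k. k < n \<Longrightarrow> blk_idx \<tau> k = c (\<pi> k)"
proof -
  define \<tau> where "\<tau> = map (\<lambda>i. card {k. k < n \<and> c k = i}) [0..<m]"
  have len: "length \<tau> = m" by (simp add: \<tau>_def)
  have "sum_list \<tau> = (\<Sum>i<m. card {k. k < n \<and> c k = i})"
    by (simp add: \<tau>_def sum_list_sum_nth atLeast0LessThan)
  also have "\<dots> = card (\<Union>i<m. {k. k < n \<and> c k = i})"
    by (rule card_UN_disjoint[symmetric]) auto
  also have "(\<Union>i<m. {k. k < n \<and> c k = i}) = {..<n}"
    using surj by auto
  finally have sum: "sum_list \<tau> = n" by simp
  have "card {k. k < n \<and> c k = i} > 0" if "i < m" for i
  proof -
    have "i \<in> c ` {..<n}" using that surj by simp
    then show ?thesis by (auto simp: card_gt_0_iff)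
  qed
  then have part: "is_partition n \<tau>"
    using sum by (auto simp: is_partition_def \<tau>_def)
  have cards: "card {k. k < n \<and> blk_idx \<tau> k = i} = card {k. k < n \<and> c k = i}" for i
  proof (cases "i < m")
    case True
    then show ?thesis using card_blk_idx[of i \<tau>] sum len by (simp add: \<tau>_def)
  next
    case False
    have "{k. k < n \<and> blk_idx \<tau> k = i} = {}"
      using blk_idx_decomp(1)[of _ \<tau>] False sum len by auto
    moreover have "{k. k < n \<and> c k = i} = {}"
      using surj False by auto
    ultimately show ?thesis by (metis card.empty)
  qed
  \<comment> \<open>Equal fiber sizes mean equal multisets of colors, and then the two colorings
    differ by a permutation of the indices.\<close>
  have "image_mset (blk_idx \<tau>) (mset_set {..<n}) = image_mset c (mset_set {..<n})"
  proof (rule multiset_eqI)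
    fix i
    have "blk_idx \<tau> -` {i} \<inter> {..<n} = {k. k < n \<and> blk_idx \<tau> k = i}"
      "c -` {i} \<inter> {..<n} = {k. k < n \<and> c k = i}" by auto
    then show "count (image_mset (blk_idx \<tau>) (mset_set {..<n})) i = count (image_mset c (mset_set {..<n})) i"
      using cards[of i] by (simp add: count_image_mset_eq_card_vimage)
  qed
  then obtain \<pi> where "\<pi> permutes {..<n}" "\<forall>k\<in>{..<n}. blk_idx \<tau> k = c (\<pi> k)"
    using image_mset_eq_implies_permutes[of "{..<n}" "blk_idx \<tau>" c] by auto
  with part len that show thesis by auto
qed

section \<open>Permuted partitions and block permutations\<close>

lemma perm_part_eqI:
  assumes \<sigma>: "\<sigma> permutes {0..<length \<tau>}" and len: "length \<tau>' = length \<tau>"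
    and eq: "\<And>i. i < length \<tau> \<Longrightarrow> \<tau>' ! \<sigma> i = \<tau> ! i"
  shows "\<tau>' = perm_part \<tau> \<sigma>"
proof (rule nth_equalityI)
  show "length \<tau>' = length (perm_part \<tau> \<sigma>)"
    by (simp add: perm_part_def len)
  fix j assume "j < length \<tau>'"
  then have "j \<in> \<sigma> ` {0..<length \<tau>}"
    using permutes_image[OF \<sigma>] len by simp
  then obtain i where i: "i < length \<tau>" "j = \<sigma> i" by auto
  have j: "j < length \<tau>" using \<open>j < length \<tau>'\<close> len by simp
  have "perm_part \<tau> \<sigma> ! j = (\<Sum>l<length \<tau>. \<tau> ! l * (if j = \<sigma> l then 1 else 0))"
    using j by (simp add: perm_part_def)
  also have "\<dots> = (\<Sum>l<length \<tau>. if l = i then \<tau> ! i else 0)"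
    using i by (intro sum.cong) (auto simp: inj_eq[OF permutes_inj[OF \<sigma>]])
  also have "\<dots> = \<tau>' ! j"
    using i eq by simp
  finally show "\<tau>' ! j = perm_part \<tau> \<sigma> ! j" ..
qed

text \<open>A matrix supported on the blocks \<open>(i, \<sigma> i)\<close> becomes block diagonal
  once column block \<open>\<sigma> i\<close> is moved to place \<open>i\<close>; undoing this move
  is the block permutation.\<close>

lemma equiv_solI:
  fixes W Z :: "complex mat"
  assumes \<tau>: "sum_list \<tau> = n" and \<tau>': "sum_list \<tau>' = n"
    and \<sigma>: "\<sigma> permutes {0..<length \<tau>}" and len: "length \<tau>' = length \<tau>"
    and sizes: "\<And>i. i < length \<tau> \<Longrightarrow> \<tau>' ! \<sigma> i = \<tau> ! i"
    and W: "W \<in> carrier_mat n n" and Z: "Z \<in> carrier_mat n n" "det Z \<noteq> 0"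
    and supp: "\<And>k l. k < n \<Longrightarrow> l < n \<Longrightarrow> blk_idx \<tau>' l \<noteq> \<sigma> (blk_idx \<tau> k) \<Longrightarrow> Z $$ (k,l) = 0"
  shows "equiv_sol n (\<tau>, W) (\<tau>', W * Z)"
proof -
  have pp: "\<tau>' = perm_part \<tau> \<sigma>"
    using \<sigma> len sizes by (rule perm_part_eqI)
  have \<sigma>_lt: "\<sigma> i < length \<tau>'" if "i < length \<tau>" for i
    using permutes_in_image[OF \<sigma>, of i] that len by simp
  \<comment> \<open>Sends position \<open>a\<close> of block \<open>i\<close> of
    \<open>\<tau>\<close> to position \<open>a\<close> of block \<open>\<sigma> i\<close> of
    \<open>\<tau>'\<close>.\<close>
  define \<pi> where "\<pi> k = blk_off \<tau>' (\<sigma> (blk_idx \<tau> k)) + (k - blk_off \<tau> (blk_idx \<tau> k))" for k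
  have \<pi>_offset: "\<pi> (blk_off \<tau> i + a) = blk_off \<tau>' (\<sigma> i) + a" if "i < length \<tau>" "a < \<tau> ! i" for i a
    using that by (simp add: \<pi>_def blk_idx_offset)
  have \<pi>_idx: "blk_idx \<tau>' (\<pi> k) = \<sigma> (blk_idx \<tau> k)" and \<pi>_lt: "\<pi> k < n" if "k < n" for k
  proof -
    let ?i = "blk_idx \<tau> k" and ?a = "k - blk_off \<tau> (blk_idx \<tau> k)"
    have "?i < length \<tau>" "?a < \<tau> ! ?i"
      using blk_idx_decomp[of k \<tau>] that \<tau> by auto
    then have lt: "\<sigma> ?i < length \<tau>'" "?a < \<tau>' ! \<sigma> ?i"
      using \<sigma>_lt sizes by auto
    show "blk_idx \<tau>' (\<pi> k) = \<sigma> (blk_idx \<tau> k)" "\<pi> k < n"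
      unfolding \<pi>_def using blk_idx_offset[OF lt] blk_off_add_less[OF lt] \<tau>' by simp_all
  qed
  have \<pi>_inj: "k = l" if "k < n" "l < n" "\<pi> k = \<pi> l" for k l
  proof -
    have "\<sigma> (blk_idx \<tau> k) = \<sigma> (blk_idx \<tau> l)"
      using \<pi>_idx that by metis
    then have "blk_idx \<tau> k = blk_idx \<tau> l"
      by (simp add: inj_eq[OF permutes_inj[OF \<sigma>]])
    with that(3) blk_idx_decomp(2)[of k \<tau>] blk_idx_decomp(2)[of l \<tau>] that(1,2) \<tau> show ?thesis
      by (simp add: \<pi>_def)
  qed
  have \<pi>_surj: "\<exists>m<n. l = \<pi> m" if "l < n" for l
  proof -
    have "\<pi> ` {..<n} = {..<n}"
      using \<pi>_lt \<pi>_inj by (intro endo_inj_surj) (auto simp: inj_on_def)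
    then have "l \<in> \<pi> ` {..<n}" using that by simp
    then show ?thesis by auto
  qed
  \<comment> \<open>\<open>PM\<close> is the matrix of \<open>\<pi>\<close>, and \<open>D\<close> is
    \<open>Z\<close> with its columns pulled back along \<open>\<pi>\<close>, so that
    \<open>D * PM = Z\<close>; the determinants then show that \<open>D\<close> is
    nonsingular.\<close>
  define PM :: "complex mat" where "PM = mat n n (\<lambda>(k,l). if l = \<pi> k then 1 else 0)"
  define D where "D = mat n n (\<lambda>(k,l). Z $$ (k, \<pi> l))"
  have PM: "PM \<in> carrier_mat n n" and D: "D \<in> carrier_mat n n"
    by (simp_all add: PM_def D_def)
  have DPM: "D * PM = Z"
  proof (rule eq_matI)
    fix k l assume "k < dim_row Z" "l < dim_col Z"
    then have kl: "k < n" "l < n" using Z by auto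
    obtain m where m: "m < n" "l = \<pi> m" using \<pi>_surj kl by blast
    have "(D * PM) $$ (k,l) = (\<Sum>i<n. if i = m then Z $$ (k, \<pi> m) else 0)"
      unfolding mult_mat_entry[OF D PM kl] using m kl \<pi>_inj
      by (intro sum.cong) (auto simp: D_def PM_def)
    then show "(D * PM) $$ (k,l) = Z $$ (k,l)"
      using m by simp
  qed (use D PM Z in auto)
  have "det D * det PM = det Z"
    using det_mult[OF D PM] DPM by simp
  then have dD: "det D \<noteq> 0" using Z by auto
  have bD: "block_diag n \<tau> D"
    unfolding block_diag_def
  proof (intro conjI D allI impI)
    fix k l assume kl: "k < n" "l < n" "blk_idx \<tau> k \<noteq> blk_idx \<tau> l"
    then have "\<sigma> (blk_idx \<tau> l) \<noteq> \<sigma> (blk_idx \<tau> k)"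
      by (simp add: inj_eq[OF permutes_inj[OF \<sigma>]])
    then show "D $$ (k,l) = 0"
      using kl \<pi>_idx \<pi>_lt by (simp add: D_def supp)
  qed
  have bP: "block_perm n \<tau> \<sigma> PM"
    unfolding block_perm_def pp[symmetric]
  proof (intro conjI PM allI impI)
    show "PM $$ (k,l) = 0" if "k < n" "l < n" "blk_idx \<tau>' l \<noteq> \<sigma> (blk_idx \<tau> k)" for k l
      using that \<pi>_idx by (auto simp: PM_def)
    fix i assume i: "i < length \<tau>"
    \<comment> \<open>Since \<open>\<pi>\<close> keeps positions within blocks, the inner
      permutation is the identity.\<close>
    show "\<exists>\<rho>. \<rho> permutes {0..<\<tau> ! i} \<and> (\<forall>a<\<tau> ! i. \<forall>b<\<tau> ! i.
        PM $$ (blk_off \<tau> i + a, blk_off \<tau>' (\<sigma> i) + b) = (if b = \<rho> a then 1 else 0))"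
      using i \<tau> \<tau>' \<sigma>_lt[OF i] sizes[OF i] blk_off_add_less[of i \<tau>] blk_off_add_less[of "\<sigma> i" \<tau>']
      by (intro exI[of _ id]) (auto simp: PM_def \<pi>_offset permutes_id)
  qed
  have "W * Z = W * D * PM"
    unfolding assoc_mult_mat[OF W D PM] DPM ..
  with \<sigma> bD dD bP pp show ?thesis
    unfolding equiv_sol_def prod.case by blast
qed

section \<open>Eigenvectors of block diagonalized matrices\<close>

lemma in_diag_class_carrier: "in_diag_class dc n W \<Longrightarrow> W \<in> carrier_mat n n"
  by (simp add: in_diag_class_def)

lemma in_diag_class_det_nonzero:
  assumes "in_diag_class dc n W"
  shows "det W \<noteq> 0"
proof -
  note W = in_diag_class_carrier[OF assms]
  have "det W \<noteq> 0" if "star W * W = 1\<^sub>m n"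
  proof -
    have "det (star W) * det W = 1"
      using det_mult[OF star_carrier[OF W] W] that by simp
    then show ?thesis by auto
  qed
  then show ?thesis
    using assms by (auto simp: in_diag_class_def split: diag_class.splits)
qed

text \<open>Seen as fixed points of a multiplicative conjugation, real matrices are closed under
  products and inverses.\<close>

lemma real_mat_iff_cnj: "real_mat A \<longleftrightarrow> map_mat cnj A = A"
  by (auto simp: real_mat_def mat_eq_iff complex_eq_iff)

lemma map_mat_cnj_mult:
  assumes A: "A \<in> carrier_mat n m" and B: "B \<in> carrier_mat m l"
  shows "map_mat cnj (A * B) = map_mat cnj A * map_mat cnj B"
proof (rule eq_matI)
  fix i j assume "i < dim_row (map_mat cnj A * map_mat cnj B)" "j < dim_col (map_mat cnj A * map_mat cnj B)"
  then have ij: "i < n" "j < l" using A B by auto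
  have cA: "map_mat cnj A \<in> carrier_mat n m" and cB: "map_mat cnj B \<in> carrier_mat m l"
    using A B by auto
  have "map_mat cnj (A * B) $$ (i,j) = cnj ((A * B) $$ (i,j))"
    using ij A B by simp
  also have "\<dots> = (map_mat cnj A * map_mat cnj B) $$ (i,j)"
    unfolding mult_mat_entry[OF A B ij] mult_mat_entry[OF cA cB ij] using ij A B by simp
  finally show "map_mat cnj (A * B) $$ (i,j) = (map_mat cnj A * map_mat cnj B) $$ (i,j)" .
qed (use A B in auto)

lemma real_mat_mult:
  assumes "A \<in> carrier_mat n m" "B \<in> carrier_mat m l" "real_mat A" "real_mat B"
  shows "real_mat (A * B)"
  using assms by (simp add: real_mat_iff_cnj map_mat_cnj_mult)

lemma inverse_mat_unique:
  fixes W :: "'a::semiring_1 mat"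
  assumes W: "W \<in> carrier_mat n n" and V: "V \<in> carrier_mat n n" and U: "U \<in> carrier_mat n n"
    and "U * W = 1\<^sub>m n" "W * V = 1\<^sub>m n"
  shows "U = V"
proof -
  have "U * (W * V) = V"
    unfolding assoc_mult_mat[OF U W V, symmetric] assms(4) by (rule left_mult_one_mat[OF V])
  then show ?thesis
    unfolding assms(5) right_mult_one_mat[OF U] .
qed

text \<open>The conjugate of \<open>V\<close> is also a left inverse of the real \<open>W\<close>,
  and inverses are unique.\<close>

lemma real_mat_inverse:
  assumes W: "W \<in> carrier_mat n n" and V: "V \<in> carrier_mat n n"
    and WV: "W * V = 1\<^sub>m n" and VW: "V * W = 1\<^sub>m n" and real: "real_mat W"
  shows "real_mat V"
proof -
  have "map_mat cnj V * W = map_mat cnj (V * W)"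
    using real map_mat_cnj_mult[OF V W] by (simp add: real_mat_iff_cnj)
  also have "\<dots> = 1\<^sub>m n"
    unfolding VW by (rule eq_matI) auto
  finally have "map_mat cnj V = V"
    by (rule inverse_mat_unique[OF W V map_carrier_mat[THEN iffD2, OF V] _ WV])
  then show ?thesis by (simp add: real_mat_iff_cnj)
qed

lemma real_color_proj: "real_mat (color_proj n c a)"
  by (simp add: real_mat_def color_proj_def)

lemma star_one: "star (1\<^sub>m n) = 1\<^sub>m n"
  by (rule eq_matI) (auto simp: star_def)

lemma star_color_proj: "star (color_proj n c a) = color_proj n c a"
  by (rule eq_matI) (auto simp: star_def color_proj_def)

section \<open>Each eigenvector lies in a single block\<close>

lemma mult_mat_vec_zero: "A \<in> carrier_mat m n \<Longrightarrow> A *\<^sub>v 0\<^sub>v n = 0\<^sub>v m"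
  by (rule eq_vecI) auto

text \<open>Restricting \<open>V *\<^sub>v x\<close> to the coordinates of one block commutes with
  the block diagonal matrix, so the restriction again yields a kernel vector of \<open>P\<close>. As
  the kernel is one-dimensional, that vector is a multiple of \<open>x\<close>.\<close>

lemma eigenvector_in_block:
  fixes P :: "complex mat"
  assumes W: "W \<in> carrier_mat n n" and V: "V \<in> carrier_mat n n"
    and WV: "W * V = 1\<^sub>m n" and VW: "V * W = 1\<^sub>m n"
    and P: "P \<in> carrier_mat n n" and blk: "blocked n b b (star W * P * W)"
    and dim: "kernel_dim P = 1"
    and x: "x \<in> carrier_vec n" "x \<noteq> 0\<^sub>v n" "P *\<^sub>v x = 0\<^sub>v n"
  obtains a where "\<And>i. i < n \<Longrightarrow> b i \<noteq> a \<Longrightarrow> (V *\<^sub>v x) $ i = 0"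
proof -
  define y where "y = V *\<^sub>v x"
  have y: "y \<in> carrier_vec n" using V x by (simp add: y_def)
  have Wy: "W *\<^sub>v y = x"
    using assoc_mult_mat_vec[OF W V x(1)] x by (simp add: y_def WV)
  have "\<exists>k<n. y $ k \<noteq> 0"
  proof (rule ccontr)
    assume "\<not> ?thesis"
    then have "y = 0\<^sub>v n" using y by (intro eq_vecI) auto
    then have "x = 0\<^sub>v n" using Wy W by auto
    with x show False by simp
  qed
  \<comment> \<open>Any nonzero coordinate selects the block. There \<open>y\<close> and its
    restriction agree, which later forces the factor \<open>l\<close> to be one.\<close>
  then obtain k where k: "k < n" "y $ k \<noteq> 0" by blast
  define C :: "complex mat" where "C = color_proj n b (b k)"
  define y' where "y' = C *\<^sub>v y"
  define Q where "Q = star W * P * W"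
  have C: "C \<in> carrier_mat n n" by (simp add: C_def)
  have sW: "star W \<in> carrier_mat n n" and sV: "star V \<in> carrier_mat n n"
    using W V by auto
  have Q: "Q \<in> carrier_mat n n" using blk unfolding Q_def by (rule blocked_carrier)
  have y': "y' \<in> carrier_vec n" using C y by (simp add: y'_def)
  have y'_entry: "y' $ i = (if b i = b k then y $ i else 0)" if "i < n" for i
  proof -
    have "y' $ i = (\<Sum>j<n. C $$ (i,j) * y $ j)"
      using that y C by (simp add: y'_def scalar_prod_def atLeast0LessThan)
    also have "\<dots> = (\<Sum>j<n. if j = i then (if b i = b k then y $ i else 0) else 0)"
      using that by (intro sum.cong) (auto simp: C_def color_proj_def)
    finally show ?thesis using that by simp
  qed
  have Q_vec: "Q *\<^sub>v z = star W *\<^sub>v (P *\<^sub>v (W *\<^sub>v z))" if "z \<in> carrier_vec n" for z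
    using that sW W P by (simp add: Q_def assoc_mult_mat_vec[of _ n n _ n] mult_carrier_mat[of _ n n _ n])
  have "Q *\<^sub>v y = 0\<^sub>v n"
    using sW by (simp add: Q_vec[OF y] Wy x mult_mat_vec_zero)
  then have "C * Q *\<^sub>v y = 0\<^sub>v n"
    using C Q y by (simp add: assoc_mult_mat_vec[OF C Q y] mult_mat_vec_zero)
  also have "C * Q = Q * C"
    unfolding C_def Q_def by (rule color_proj_commute[OF blk])
  finally have "star W *\<^sub>v (P *\<^sub>v (W *\<^sub>v y')) = 0\<^sub>v n"
    by (simp add: assoc_mult_mat_vec[OF Q C y] y'_def[symmetric] Q_vec[OF y'])
  \<comment> \<open>The transformation is a congruence, not a similarity; the outer factor
    \<open>star W\<close> is cancelled by its inverse \<open>star V\<close>.\<close>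
  then have "star V *\<^sub>v (star W *\<^sub>v (P *\<^sub>v (W *\<^sub>v y'))) = 0\<^sub>v n"
    using sV by (simp add: mult_mat_vec_zero)
  moreover have "star V * star W = 1\<^sub>m n"
    using star_mult[OF W V] by (simp add: WV star_one)
  ultimately have "P *\<^sub>v (W *\<^sub>v y') = 0\<^sub>v n"
    using assoc_mult_mat_vec[OF sV sW, of "P *\<^sub>v (W *\<^sub>v y')"] P W y' by simp
  then have "W *\<^sub>v y' \<in> mat_kernel P"
    using P W y' by (intro mat_kernelI[of _ n n]) auto
  moreover have "x \<in> mat_kernel P"
    using P x by (intro mat_kernelI[of _ n n]) auto
  ultimately obtain l where l: "W *\<^sub>v y' = l \<cdot>\<^sub>v x"
    using kernel_dim_one_multiple[OF P dim _ x(2)] by blast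
  have "y' = V *\<^sub>v (W *\<^sub>v y')"
    using assoc_mult_mat_vec[OF V W y'] y' by (simp add: VW)
  also have "\<dots> = l \<cdot>\<^sub>v y"
    using V x by (simp add: l y_def mult_mat_vec)
  finally have eq: "y' = l \<cdot>\<^sub>v y" .
  have "y $ k = l * y $ k"
    using y'_entry[OF k(1)] k y by (simp add: eq)
  then have "l = 1" using k by simp
  then have "y' = y" using eq by simp
  show thesis
  proof (rule that[of "b k"])
    fix i assume "i < n" "b i \<noteq> b k"
    then show "(V *\<^sub>v x) $ i = 0"
      using y'_entry[of i] \<open>y' = y\<close> by (simp add: y_def)
  qed
qed

text \<open>Congruence is linear in the middle factor. This carries block diagonality from the
  \<open>As i\<close> to the values of a matrix polynomial in their span.\<close>

lemma blocked_lin_comb: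
  assumes W: "W \<in> carrier_mat n n" and As: "\<forall>i\<le>p. As i \<in> carrier_mat n n"
    and blk: "\<forall>i\<le>p. blocked n b b (star W * As i * W)"
  shows "blocked n b b (star W * lin_comb n As p \<alpha> * W)"
proof -
  have sW: "star W \<in> carrier_mat n n" using W by simp
  have L: "lin_comb n As p \<alpha> \<in> carrier_mat n n" by (simp add: lin_comb_def)
  have entry: "(star W * M * W) $$ (k,l) = (\<Sum>j<n. \<Sum>i<n. star W $$ (k,i) * M $$ (i,j) * W $$ (j,l))"
    if "M \<in> carrier_mat n n" "k < n" "l < n" for M k l
    unfolding mult_mat_entry[OF mult_carrier_mat[OF sW that(1)] W that(2,3)]
    by (intro sum.cong refl) (simp add: mult_mat_entry[OF sW that(1,2)] sum_distrib_right del: index_mult_mat(1))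
  show ?thesis
    unfolding blocked_def
  proof (intro conjI allI impI)
    show "star W * lin_comb n As p \<alpha> * W \<in> carrier_mat n n"
      using sW L W by (intro mult_carrier_mat)
    fix k l assume kl: "k < n" "l < n" "b k \<noteq> b l"
    have "(star W * lin_comb n As p \<alpha> * W) $$ (k,l)
        = (\<Sum>j<n. \<Sum>i<n. \<Sum>m\<le>p. \<alpha> m * (star W $$ (k,i) * As m $$ (i,j) * W $$ (j,l)))"
      unfolding entry[OF L kl(1,2)]
      by (intro sum.cong refl) (simp add: lin_comb_def sum_distrib_left sum_distrib_right mult_ac)
    also have "\<dots> = (\<Sum>j<n. \<Sum>m\<le>p. \<Sum>i<n. \<alpha> m * (star W $$ (k,i) * As m $$ (i,j) * W $$ (j,l)))"
      by (intro sum.cong refl sum.swap)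
    also have "\<dots> = (\<Sum>m\<le>p. \<Sum>j<n. \<Sum>i<n. \<alpha> m * (star W $$ (k,i) * As m $$ (i,j) * W $$ (j,l)))"
      by (rule sum.swap)
    also have "\<dots> = (\<Sum>m\<le>p. \<alpha> m * (star W * As m * W) $$ (k,l))"
      using As by (intro sum.cong refl) (simp add: entry kl sum_distrib_left del: index_mult_mat(1))
    also have "\<dots> = 0"
      using blk kl by (intro sum.neutral) (auto simp: blocked_def simp del: index_mult_mat(1))
    finally show "(star W * lin_comb n As p \<alpha> * W) $$ (k,l) = 0" .
  qed
qed

section \<open>The common refinement of two solutions\<close>

text \<open>By hypothesis a coordinate has color \<open>r j\<close> exactly when it has both colors
  \<open>s j\<close> and \<open>s' j\<close>, and a product of coordinate projectors selects the
  intersection.\<close>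

lemma color_proj_mult_pair:
  assumes r: "\<And>i k. i < n \<Longrightarrow> k < n \<Longrightarrow> r i = r k \<longleftrightarrow> s i = s k \<and> s' i = s' k" and j: "j < n"
  shows "color_proj n s (s j) * color_proj n s' (s' j) = (color_proj n r (r j) :: 'a::semiring_1 mat)"
proof (rule eq_matI)
  fix i k assume "i < dim_row (color_proj n r (r j) :: 'a mat)" "k < dim_col (color_proj n r (r j) :: 'a mat)"
  then have ik: "i < n" "k < n" by (auto simp: color_proj_def)
  show "(color_proj n s (s j) * color_proj n s' (s' j)) $$ (i,k) = (color_proj n r (r j) :: 'a mat) $$ (i,k)"
    unfolding color_proj_mult_entry[OF color_proj_carrier ik] using ik r[OF ik(1) j]
    by (auto simp: color_proj_def)
qed (auto simp: color_proj_def)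

text \<open>\<open>V * X\<close> intertwines the color projectors of blocks and eigenvectors. A
  projector formed from possibly complex eigenvectors thus equals one formed from the diagonalizer,
  and inherits its realness or symmetry.\<close>

lemma sandwich_color_proj_eq:
  fixes W V X Y :: "'a::semiring_1 mat"
  assumes W: "W \<in> carrier_mat n n" and V: "V \<in> carrier_mat n n"
    and X: "X \<in> carrier_mat n n" and Y: "Y \<in> carrier_mat n n"
    and WV: "W * V = 1\<^sub>m n" and XY: "X * Y = 1\<^sub>m n"
    and blk: "blocked n b s (V * X)"
  shows "X * color_proj n s a * Y = W * color_proj n b a * V"
proof -
  let ?B = "color_proj n b a :: 'a mat" and ?S = "color_proj n s a :: 'a mat"
  note [simp] = assoc_mult_mat[of _ n n _ n _ n] mult_carrier_mat[of _ n n _ n]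
  have VX: "V * X \<in> carrier_mat n n" using V X by simp
  have "W * ?B * V = W * ?B * V * (X * Y)"
    using W V by (simp add: XY right_mult_one_mat[of _ n n])
  also have "\<dots> = W * (?B * (V * X)) * Y"
    using W V X Y by (simp del: XY)
  also have "\<dots> = (W * V) * (X * ?S * Y)"
    unfolding color_proj_commute[OF blk] using W V X Y by (simp del: WV)
  also have "\<dots> = X * ?S * Y"
    using X Y by (simp add: WV left_mult_one_mat[of _ n n])
  finally show ?thesis ..
qed

lemma real_sandwich_color_proj:
  assumes W: "W \<in> carrier_mat n n" and V: "V \<in> carrier_mat n n"
    and "W * V = 1\<^sub>m n" "V * W = 1\<^sub>m n" "real_mat W"
  shows "real_mat (W * color_proj n b a * V)"
  using assms real_mat_inverse[OF assms]
  by (intro real_mat_mult[of _ n n _ n] real_color_proj mult_carrier_mat[of _ n n]) auto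

lemma star_sandwich_color_proj:
  assumes W: "W \<in> carrier_mat n n" and V: "V \<in> carrier_mat n n"
    and WV: "W * V = 1\<^sub>m n" and WW: "star W * W = 1\<^sub>m n"
  shows "star (W * color_proj n b a * V) = W * color_proj n b a * V"
proof -
  have V_eq: "V = star W"
    using inverse_mat_unique[OF W V star_carrier[OF W] WW WV] ..
  have "star (W * color_proj n b a * V) = star V * (color_proj n b a * star W)"
    using W V star_mult[of "W * color_proj n b a" n n V n] star_mult[of W n n "color_proj n b a" n]
    by (simp add: star_color_proj mult_carrier_mat[of _ n n])
  then show ?thesis
    unfolding V_eq star_star using W star_carrier[OF W] by (simp add: assoc_mult_mat[of _ n n _ n _ n])
qed

text \<open>Column \<open>j\<close> of \<open>V * X\<close> is \<open>V *\<^sub>v x j\<close>. The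
  value of the polynomial at \<open>lam j\<close> lies in the span of the \<open>As i\<close> and
  has a one-dimensional kernel, so this column is supported in a single block, called
  \<open>s j\<close>.\<close>

lemma JBD_sol_coloring:
  assumes sol: "JBD_sol dc n As p \<tau> W" and As: "\<forall>i\<le>p. As i \<in> carrier_mat n n"
    and span: "\<And>z. mat_poly n Bs q z \<in> span_mats n As p"
    and eig: "\<forall>j<n. eigenpair n (mat_poly n Bs q) (lam j) (x j)"
    and gm: "\<forall>j<n. geom_mult (mat_poly n Bs q) (lam j) = 1"
  defines "X \<equiv> mat n n (\<lambda>(k,j). x j $ k)"
  obtains V s where "V \<in> carrier_mat n n" "W * V = 1\<^sub>m n" "V * W = 1\<^sub>m n"
    "blocked n (blk_idx \<tau>) s (V * X)"
proof -
  have W: "W \<in> carrier_mat n n" and dW: "det W \<noteq> 0"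
    using sol in_diag_class_carrier in_diag_class_det_nonzero by (auto simp: JBD_sol_def)
  obtain V where V: "V \<in> carrier_mat n n" and WV: "W * V = 1\<^sub>m n" and VW: "V * W = 1\<^sub>m n"
    using mat_inverse_exists[OF W dW] .
  have blk: "\<forall>i\<le>p. blocked n (blk_idx \<tau>) (blk_idx \<tau>) (star W * As i * W)"
    using sol by (simp add: JBD_sol_def block_diag_iff_blocked)
  have "\<exists>a. \<forall>i<n. blk_idx \<tau> i \<noteq> a \<longrightarrow> (V *\<^sub>v x j) $ i = 0" if "j < n" for j
  proof -
    let ?P = "mat_poly n Bs q (lam j)"
    have P: "?P \<in> carrier_mat n n" by (simp add: mat_poly_def lin_comb_def)
    have "blocked n (blk_idx \<tau>) (blk_idx \<tau>) (star W * ?P * W)"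
      using span[of "lam j"] blocked_lin_comb[OF W As blk] by (auto simp: span_mats_def)
    moreover have "kernel_dim ?P = 1"
      using gm that by (simp add: geom_mult_def)
    moreover have "x j \<in> carrier_vec n" "x j \<noteq> 0\<^sub>v n" "?P *\<^sub>v x j = 0\<^sub>v n"
      using eig that by (auto simp: eigenpair_def)
    ultimately show ?thesis
      using eigenvector_in_block[OF W V WV VW P] by metis
  qed
  then obtain s where s: "\<And>i j. i < n \<Longrightarrow> j < n \<Longrightarrow> blk_idx \<tau> i \<noteq> s j \<Longrightarrow> (V *\<^sub>v x j) $ i = 0"
    by metis
  have X: "X \<in> carrier_mat n n" by (simp add: X_def)
  have "(V * X) $$ (i,j) = (V *\<^sub>v x j) $ i" if "i < n" "j < n" for i j
  proof -
    have "col X j = x j"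
      using that eig by (intro eq_vecI) (auto simp: X_def eigenpair_def)
    then show ?thesis using that V X by simp
  qed
  then have "blocked n (blk_idx \<tau>) s (V * X)"
    using s V X unfolding blocked_def by simp
  with V WV VW show thesis by (rule that)
qed

text \<open>A color is attained exactly when its finite fiber has nonzero cardinality.\<close>

lemma image_eq_if_card_fibers_eq:
  fixes c r :: "nat \<Rightarrow> 'c"
  assumes "\<And>a. card {k. k < n \<and> r k = a} = card {k. k < n \<and> c k = a}"
  shows "c ` {..<n} = r ` {..<n}"
proof -
  have "f ` {..<n} = {a. card {k. k < n \<and> f k = a} \<noteq> 0}" for f :: "nat \<Rightarrow> 'c"
    by auto
  then show ?thesis by (simp only: assms)
qed

text \<open>\<open>V * X\<close> has the inverse \<open>Y * W\<close>, and an invertible blocked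
  matrix has as many columns as rows of each color. Blocks have positive size, so each one receives
  an eigenvector.\<close>

lemma coloring_card:
  fixes V X Y W :: "complex mat"
  assumes \<tau>: "is_partition n \<tau>"
    and blk: "blocked n (blk_idx \<tau>) s (V * X)" and Y: "Y \<in> carrier_mat n n" and W: "W \<in> carrier_mat n n"
    and V: "V \<in> carrier_mat n n" and X: "X \<in> carrier_mat n n"
    and WV: "W * V = 1\<^sub>m n" and VW: "V * W = 1\<^sub>m n" and XY: "X * Y = 1\<^sub>m n" and YX: "Y * X = 1\<^sub>m n"
  shows "\<And>i. i < length \<tau> \<Longrightarrow> card {j. j < n \<and> s j = i} = \<tau> ! i" and "s ` {..<n} = {..<length \<tau>}"
proof -
  have YW: "Y * W \<in> carrier_mat n n" using Y W by simp
  have "(V * X) * (Y * W) = V * ((X * Y) * W)"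
    using V X Y W by (simp add: assoc_mult_mat[of _ n n _ n _ n] mult_carrier_mat[of _ n n _ n])
  then have i1: "(V * X) * (Y * W) = 1\<^sub>m n"
    using W by (simp add: XY VW)
  have i2: "(Y * W) * (V * X) = 1\<^sub>m n"
    using mat_mult_left_right_inverse[OF blocked_carrier[OF blk] YW i1] .
  have eq: "card {k. k < n \<and> blk_idx \<tau> k = i} = card {j. j < n \<and> s j = i}" for i
    by (rule card_color_eq[OF blk YW i1 i2])
  have sum: "sum_list \<tau> = n" using \<tau> by (simp add: is_partition_def)
  show "card {j. j < n \<and> s j = i} = \<tau> ! i" if "i < length \<tau>" for i
    using eq[of i] card_blk_idx[OF that] sum by simp
  have "s ` {..<n} = blk_idx \<tau> ` {..<n}"
    using eq by (rule image_eq_if_card_fibers_eq)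
  also have "\<dots> = {..<length \<tau>}"
  proof
    show "blk_idx \<tau> ` {..<n} \<subseteq> {..<length \<tau>}"
      using blk_idx_decomp(1)[of _ \<tau>] sum by auto
    show "{..<length \<tau>} \<subseteq> blk_idx \<tau> ` {..<n}"
    proof
      fix i assume "i \<in> {..<length \<tau>}"
      then have i: "i < length \<tau>" "0 < \<tau> ! i"
        using \<tau> by (auto simp: is_partition_def)
      then show "i \<in> blk_idx \<tau> ` {..<n}"
        using blk_idx_offset[OF i] blk_off_add_less[OF i] sum
        by (intro image_eqI[of _ _ "blk_off \<tau> i"]) simp_all
    qed
  qed
  finally show "s ` {..<n} = {..<length \<tau>}" .
qed

text \<open>The orthogonal and unitary classes take orthonormal bases of the ranges of Hermitian
  projectors. For the nonsingular classes, columns of the projectors suffice, and these are real if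
  the projectors are.\<close>

lemma exists_adapted_in_class:
  fixes r :: "nat \<Rightarrow> nat" and X Y :: "complex mat" and n :: nat
  defines "H \<equiv> \<lambda>a. X * color_proj n r a * Y"
  assumes X: "X \<in> carrier_mat n n" and Y: "Y \<in> carrier_mat n n"
    and XY: "X * Y = 1\<^sub>m n" and YX: "Y * X = 1\<^sub>m n"
    and real: "\<And>a. dc \<in> {RealOrth, RealNonsing} \<Longrightarrow> real_mat (H a)"
    and herm: "\<And>a. dc \<in> {RealOrth, Unitary} \<Longrightarrow> star (H a) = H a"
  obtains W c where "in_diag_class dc n W" "blocked n r c (Y * W)"
proof (cases "dc \<in> {RealOrth, Unitary}")
  case True
  obtain W c where W: "W \<in> carrier_mat n n" "star W * W = 1\<^sub>m n" "blocked n r c (Y * W)"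
    "(\<forall>a. real_mat (H a)) \<Longrightarrow> real_mat W"
    using exists_adapted_unitary[OF X Y XY YX herm[OF True, unfolded H_def]] unfolding H_def by blast
  have "in_diag_class dc n W"
    using True W real by (auto simp: in_diag_class_def)
  with W(3) show thesis using that by blast
next
  case False
  obtain W c where W: "W \<in> carrier_mat n n" "det W \<noteq> 0" "blocked n r c (Y * W)"
    and entry: "\<And>k l. k < n \<Longrightarrow> l < n \<Longrightarrow> W $$ (k,l) = H (c l) $$ (k,l)"
    using exists_adapted_nonsingular[OF X Y XY YX, of r] unfolding H_def by blast
  have "real_mat W" if "dc = RealNonsing"
  proof -
    have "H a \<in> carrier_mat n n" for a
      using X Y unfolding H_def by (auto intro!: mult_carrier_mat)
    then have "dim_row (H a) = n" "dim_col (H a) = n" for a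
      using carrier_matD by blast+
    then show ?thesis
      using real that entry W(1) by (simp add: real_mat_def)
  qed
  then have "in_diag_class dc n W"
    using False W by (cases dc) (auto simp: in_diag_class_def)
  with W(3) show thesis using that by blast
qed

text \<open>Allows columns to be sorted into contiguous blocks. The Gram matrix is merely permuted,
  and permuting the rows of the inverse gives the new inverse.\<close>

lemma in_diag_class_permute_cols:
  assumes W: "in_diag_class dc n W" and \<pi>: "\<pi> permutes {..<n}"
  shows "in_diag_class dc n (mat n n (\<lambda>(k,l). W $$ (k, \<pi> l)))" (is "in_diag_class dc n ?U")
proof -
  note Wc = in_diag_class_carrier[OF W]
  have \<pi>_lt: "\<pi> l < n" if "l < n" for l
    using permutes_in_image[OF \<pi>, of l] that by simp
  have U: "?U \<in> carrier_mat n n" by simp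
  have "star ?U * ?U = 1\<^sub>m n" if "star W * W = 1\<^sub>m n"
  proof (rule eq_matI)
    fix i j assume "i < dim_row (1\<^sub>m n :: complex mat)" "j < dim_col (1\<^sub>m n :: complex mat)"
    then have ij: "i < n" "j < n" by auto
    have "(star ?U * ?U) $$ (i,j) = (\<Sum>k<n. star W $$ (\<pi> i, k) * W $$ (k, \<pi> j))"
      unfolding mult_mat_entry[OF star_carrier[OF U] U ij]
      using ij \<pi>_lt Wc by (intro sum.cong) (simp_all add: star_def)
    also have "\<dots> = (star W * W) $$ (\<pi> i, \<pi> j)"
      using mult_mat_entry[OF star_carrier[OF Wc] Wc] ij \<pi>_lt by simp
    also have "\<dots> = 1\<^sub>m n $$ (i,j)"
      unfolding that using ij \<pi>_lt inj_eq[OF permutes_inj[OF \<pi>]] by simp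
    finally show "(star ?U * ?U) $$ (i,j) = 1\<^sub>m n $$ (i,j)" .
  qed (auto simp: star_def)
  moreover have "real_mat ?U" if "real_mat W"
    using that \<pi>_lt carrier_matD[OF Wc] by (simp add: real_mat_def)
  moreover have "det ?U \<noteq> 0"
  proof -
    obtain V where V: "V \<in> carrier_mat n n" "W * V = 1\<^sub>m n"
      using mat_inverse_exists[OF Wc in_diag_class_det_nonzero[OF W]] by blast
    define V' where "V' = mat n n (\<lambda>(k,l). V $$ (\<pi> k, l))"
    have V': "V' \<in> carrier_mat n n" by (simp add: V'_def)
    have "?U * V' = 1\<^sub>m n"
    proof (rule eq_matI)
      fix i j assume "i < dim_row (1\<^sub>m n :: complex mat)" "j < dim_col (1\<^sub>m n :: complex mat)"
      then have ij: "i < n" "j < n" by auto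
      have "(?U * V') $$ (i,j) = (\<Sum>k<n. W $$ (i, \<pi> k) * V $$ (\<pi> k, j))"
        unfolding mult_mat_entry[OF U V' ij] using ij by (intro sum.cong) (simp_all add: V'_def)
      also have "\<dots> = (\<Sum>k<n. W $$ (i,k) * V $$ (k,j))"
        using sum.permute[OF \<pi>, of "\<lambda>k. W $$ (i,k) * V $$ (k,j)"] by (simp add: o_def)
      also have "\<dots> = 1\<^sub>m n $$ (i,j)"
        using mult_mat_entry[OF Wc V(1) ij] V(2) by simp
      finally show "(?U * V') $$ (i,j) = 1\<^sub>m n $$ (i,j)" .
    qed (simp_all add: V'_def)
    then have "det ?U * det V' = 1"
      using det_mult[OF U V'] by simp
    then show ?thesis by auto
  qed
  ultimately show ?thesis
    using W U by (cases dc) (auto simp: in_diag_class_def)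
qed

text \<open>Each \<open>star X * As i * X\<close> is blocked for \<open>s\<close> and for
  \<open>s'\<close>, hence for the pairs of colors. The projectors of the pair coloring supply a
  diagonalizer of the class \<open>dc\<close> that keeps this finer block structure.\<close>

lemma common_refinement_sol:
  fixes X Y W V W' V' :: "complex mat"
  assumes As: "\<forall>i\<le>p. As i \<in> carrier_mat n n"
    and X: "X \<in> carrier_mat n n" and Y: "Y \<in> carrier_mat n n"
    and XY: "X * Y = 1\<^sub>m n" and YX: "Y * X = 1\<^sub>m n"
    and sol: "JBD_sol dc n As p \<tau> W"
    and V: "V \<in> carrier_mat n n" and WV: "W * V = 1\<^sub>m n" and VW: "V * W = 1\<^sub>m n"
    and blk: "blocked n (blk_idx \<tau>) s (V * X)"
    and sol': "JBD_sol dc n As p \<tau>' W'"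
    and V': "V' \<in> carrier_mat n n" and WV': "W' * V' = 1\<^sub>m n" and VW': "V' * W' = 1\<^sub>m n"
    and blk': "blocked n (blk_idx \<tau>') s' (V' * X)"
  obtains \<tau>'' W'' where "JBD_sol dc n As p \<tau>'' W''"
    "length \<tau>'' = card ((\<lambda>j. (s j, s' j)) ` {..<n})"
proof -
  have cl: "in_diag_class dc n W" "in_diag_class dc n W'"
    using sol sol' by (auto simp: JBD_sol_def)
  note W = in_diag_class_carrier[OF cl(1)] and W' = in_diag_class_carrier[OF cl(2)]
  define R where "R = (\<lambda>j. (s j, s' j)) ` {..<n}"
  have "finite R" by (simp add: R_def)
  \<comment> \<open>The occurring pairs are numbered from zero, since they are to become block
    indices.\<close>
  then obtain e where e: "bij_betw e R {0..<card R}"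
    using ex_bij_betw_finite_nat by blast
  define r where "r j = e (s j, s' j)" for j
  have r_eq: "r i = r k \<longleftrightarrow> s i = s k \<and> s' i = s' k" if "i < n" "k < n" for i k
  proof -
    have "(s i, s' i) \<in> R" "(s k, s' k) \<in> R" using that by (auto simp: R_def)
    then show ?thesis
      using inj_on_eq_iff[OF bij_betw_imp_inj_on[OF e]] by (simp add: r_def)
  qed
  have "r ` {..<n} = e ` R" by (auto simp: r_def R_def)
  then have r_img: "r ` {..<n} = {..<card R}"
    using e by (simp add: bij_betw_def atLeast0LessThan)
  define H where "H a = X * color_proj n r a * Y" for a
  define E where "E a = X * color_proj n s a * Y" for a
  define F where "F a = X * color_proj n s' a * Y" for a
  have EF_carrier: "E a \<in> carrier_mat n n" "F a \<in> carrier_mat n n" for a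
    using X Y by (auto simp: E_def F_def intro!: mult_carrier_mat)
  have E_eq: "E a = W * color_proj n (blk_idx \<tau>) a * V" for a
    unfolding E_def by (rule sandwich_color_proj_eq[OF W V X Y WV XY blk])
  have F_eq: "F a = W' * color_proj n (blk_idx \<tau>') a * V'" for a
    unfolding F_def by (rule sandwich_color_proj_eq[OF W' V' X Y WV' XY blk'])
  have sandwich: "X * C * Y * (X * D * Y) = X * (C * D) * Y"
    if "C \<in> carrier_mat n n" "D \<in> carrier_mat n n" for C D
  proof -
    have "X * C * Y * (X * D * Y) = X * C * (Y * X) * D * Y"
      using X Y that by (simp add: assoc_mult_mat[of _ n n _ n _ n] mult_carrier_mat[of _ n n _ n] del: YX)
    then show ?thesis
      using X Y that
      by (simp add: YX assoc_mult_mat[of _ n n _ n _ n] mult_carrier_mat[of _ n n _ n] left_mult_one_mat[of _ n n])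
  qed
  \<comment> \<open>Both orders of the product are recorded because \<open>star\<close> reverses the
    factors; a product of commuting Hermitian projectors is Hermitian. Colors that are not attained
    give the zero matrix.\<close>
  have H_cases: "H a = 0\<^sub>m n n \<or> (\<exists>i k. H a = E i * F k \<and> H a = F k * E i)" for a
  proof (cases "\<exists>j<n. r j = a")
    case True
    then obtain j where j: "j < n" "a = r j" by blast
    have "color_proj n s (s j) * color_proj n s' (s' j) = (color_proj n r a :: complex mat)"
      "color_proj n s' (s' j) * color_proj n s (s j) = (color_proj n r a :: complex mat)"
      unfolding j(2) by (rule color_proj_mult_pair[OF _ j(1)], use r_eq in blast)+
    then have "H a = E (s j) * F (s' j)" "H a = F (s' j) * E (s j)"
      unfolding H_def E_def F_def sandwich[OF color_proj_carrier color_proj_carrier] by simp_all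
    then show ?thesis by blast
  next
    case False
    then have "color_proj n r a = (0\<^sub>m n n :: complex mat)"
      by (intro eq_matI) (auto simp: color_proj_def)
    then have "H a = 0\<^sub>m n n" using X Y by (simp add: H_def)
    then show ?thesis ..
  qed
  have real: "real_mat (X * color_proj n r a * Y)" if dc: "dc \<in> {RealOrth, RealNonsing}" for a
  proof -
    have "real_mat W" "real_mat W'"
      using cl dc by (auto simp: in_diag_class_def)
    then have "real_mat (E i)" "real_mat (F i)" for i
      unfolding E_eq F_eq using W V WV VW W' V' WV' VW' by (auto intro!: real_sandwich_color_proj)
    then have "real_mat (E i * F k)" for i k
      using real_mat_mult[OF EF_carrier] by blast
    moreover have "real_mat (0\<^sub>m n n)"
      by (simp add: real_mat_def)
    ultimately show ?thesis
      using H_cases[of a] unfolding H_def by metis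
  qed
  have herm: "star (X * color_proj n r a * Y) = X * color_proj n r a * Y"
    if dc: "dc \<in> {RealOrth, Unitary}" for a
  proof -
    have "star W * W = 1\<^sub>m n" "star W' * W' = 1\<^sub>m n"
      using cl dc by (auto simp: in_diag_class_def)
    then have "star (E i) = E i" "star (F i) = F i" for i
      unfolding E_eq F_eq using W V WV W' V' WV' by (auto intro!: star_sandwich_color_proj)
    then have "star (E i * F k) = F k * E i" for i k
      using star_mult[OF EF_carrier] by simp
    moreover have "star (0\<^sub>m n n) = 0\<^sub>m n n"
      by (rule eq_matI) (auto simp: star_def)
    ultimately show ?thesis
      using H_cases[of a] unfolding H_def by metis
  qed
  obtain W0 c where W0: "in_diag_class dc n W0" and W0_blk: "blocked n r c (Y * W0)"
    using exists_adapted_in_class[OF X Y XY YX real herm] .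
  note W0c = in_diag_class_carrier[OF W0]
  obtain V0 where V0: "V0 \<in> carrier_mat n n" "W0 * V0 = 1\<^sub>m n" "V0 * W0 = 1\<^sub>m n"
    using mat_inverse_exists[OF W0c in_diag_class_det_nonzero[OF W0]] .
  have V0X: "V0 * X \<in> carrier_mat n n" using V0 X by simp
  have "(V0 * X) * (Y * W0) = V0 * ((X * Y) * W0)"
    using V0 X Y W0c by (simp add: assoc_mult_mat[of _ n n _ n _ n] mult_carrier_mat[of _ n n _ n] del: XY)
  then have i1: "(V0 * X) * (Y * W0) = 1\<^sub>m n"
    using W0c V0 by (simp add: XY)
  have i2: "(Y * W0) * (V0 * X) = 1\<^sub>m n"
    using mat_mult_left_right_inverse[OF V0X blocked_carrier[OF W0_blk] i1] .
  \<comment> \<open>\<open>Y * W0\<close> is invertible and blocked, so its columns use each color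
    as often as its rows do; hence all \<open>card R\<close> colors occur.\<close>
  have "c ` {..<n} = {..<card R}"
    using image_eq_if_card_fibers_eq[of n r c] card_color_eq[OF W0_blk V0X i2 i1] r_img by simp
  then obtain \<tau>'' \<pi> where \<tau>'': "is_partition n \<tau>''" "length \<tau>'' = card R" and \<pi>: "\<pi> permutes {..<n}"
    and idx: "\<And>k. k < n \<Longrightarrow> blk_idx \<tau>'' k = c (\<pi> k)"
    using exists_sorting_partition[of c n "card R"] by blast
  \<comment> \<open>Sorting the columns of \<open>W0\<close> by color turns \<open>c\<close> into
    the block index of \<open>\<tau>''\<close>.\<close>
  define W'' where "W'' = mat n n (\<lambda>(k,l). W0 $$ (k, \<pi> l))"
  have W'': "in_diag_class dc n W''"
    unfolding W''_def by (rule in_diag_class_permute_cols[OF W0 \<pi>])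
  note W''c = in_diag_class_carrier[OF W'']
  define U where "U = Y * W''"
  have "U $$ (i,l) = (Y * W0) $$ (i, \<pi> l)" if "i < n" "l < n" for i l
  proof -
    have \<pi>l: "\<pi> l < n" using permutes_in_image[OF \<pi>, of l] that by simp
    show ?thesis
      unfolding U_def mult_mat_entry[OF Y W''c that] mult_mat_entry[OF Y W0c that(1) \<pi>l]
      using that by (intro sum.cong) (simp_all add: W''_def)
  qed
  moreover have "\<pi> l < n" if "l < n" for l
    using permutes_in_image[OF \<pi>, of l] that by simp
  moreover have U: "U \<in> carrier_mat n n" using Y W''c by (simp add: U_def)
  ultimately have U_blk: "blocked n r (blk_idx \<tau>'') U"
    using W0_blk idx by (simp add: blocked_def)
  have W''_eq: "W'' = X * U"
    unfolding U_def using assoc_mult_mat[OF X Y W''c] W''c XY by simp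
  have blocks: "block_diag n \<tau>'' (star W'' * As i * W'')" if "i \<le> p" for i
  proof -
    have A: "As i \<in> carrier_mat n n" using As that by blast
    note [simp] = assoc_mult_mat[of _ n n _ n _ n] mult_carrier_mat[of _ n n _ n]
    \<comment> \<open>By \<open>X = W * (V * X)\<close> this is the congruence by
      \<open>V * X\<close> of the block diagonal \<open>star W * As i * W\<close>.\<close>
    have XAX: "blocked n c c (star X * As i * X)"
      if W: "W \<in> carrier_mat n n" and V: "V \<in> carrier_mat n n" and WV: "W * V = 1\<^sub>m n"
        and vx: "blocked n b c (V * X)" and wa: "blocked n b b (star W * As i * W)" for W V b and c :: "nat \<Rightarrow> nat"
    proof -
      have X_eq: "X = W * (V * X)"
        using assoc_mult_mat[OF W V X] WV X by simp
      have "star X = star (V * X) * star W"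
        by (subst X_eq) (rule star_mult[OF W blocked_carrier[OF vx]])
      then have "star X * As i * X = star (V * X) * star W * As i * (W * (V * X))"
        using X_eq by metis
      also have "\<dots> = star (V * X) * (star W * As i * W) * (V * X)"
        using star_carrier[OF W] star_carrier[OF blocked_carrier[OF vx]] blocked_carrier[OF vx] W A V X by simp
      finally show ?thesis
        using blocked_mult[OF blocked_mult[OF blocked_star[OF vx] wa] vx] by simp
    qed
    have "blocked n s s (star X * As i * X)"
      using XAX[OF W V WV blk] sol \<open>i \<le> p\<close> by (simp add: JBD_sol_def block_diag_iff_blocked)
    moreover have "blocked n s' s' (star X * As i * X)"
      using XAX[OF W' V' WV' blk'] sol' \<open>i \<le> p\<close> by (simp add: JBD_sol_def block_diag_iff_blocked)
    ultimately have "blocked n r r (star X * As i * X)"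
      using r_eq unfolding blocked_def by blast
    from blocked_mult[OF blocked_mult[OF blocked_star[OF U_blk] this] U_blk]
    have "blocked n (blk_idx \<tau>'') (blk_idx \<tau>'') (star U * (star X * As i * X) * U)" .
    also have "star U * (star X * As i * X) * U = star W'' * As i * W''"
      unfolding W''_eq star_mult[OF X U] using A X U star_carrier[OF X] star_carrier[OF U] by simp
    finally show ?thesis by (simp add: block_diag_iff_blocked)
  qed
  have "JBD_sol dc n As p \<tau>'' W''"
    using \<tau>'' W'' blocks by (simp add: JBD_sol_def)
  then show thesis
    using \<tau>''(2) unfolding R_def by (rule that)
qed

section \<open>Two maximal solutions differ by a block permutation\<close>

theorem theorem3p2:
  fixes mc :: mat_class and dc :: diag_class and n p q :: nat
    and As Bs :: "nat \<Rightarrow> complex mat"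
    and lam :: "nat \<Rightarrow> complex" and x :: "nat \<Rightarrow> complex vec"
  assumes A_class: "\<forall>i\<le>p. in_mat_class mc n (As i)"
    and B_dim: "\<forall>i\<le>q. Bs i \<in> carrier_mat n n"
    and span_eq: "span_mats n Bs q = span_mats n As p"
    and eig: "\<forall>j<n. eigenpair n (mat_poly n Bs q) (lam j) (x j)"
    and X_nonsing: "det (mat n n (\<lambda>(k,j). x j $ k)) \<noteq> 0"
    and gm_one: "\<forall>j<n. geom_mult (mat_poly n Bs q) (lam j) = 1"
  shows "\<forall>\<tau> W \<tau>' W'. GJBD_sol dc n As p \<tau> W \<and> GJBD_sol dc n As p \<tau>' W'
           \<longrightarrow> equiv_sol n (\<tau>, W) (\<tau>', W')"
proof (intro allI impI, elim conjE)
  fix \<tau> W \<tau>' W'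
  assume G: "GJBD_sol dc n As p \<tau> W" and G': "GJBD_sol dc n As p \<tau>' W'"
  have sol: "JBD_sol dc n As p \<tau> W" and sol': "JBD_sol dc n As p \<tau>' W'"
    and max: "\<And>\<tau>'' W''. JBD_sol dc n As p \<tau>'' W'' \<Longrightarrow> length \<tau>'' \<le> length \<tau>"
    and max': "\<And>\<tau>'' W''. JBD_sol dc n As p \<tau>'' W'' \<Longrightarrow> length \<tau>'' \<le> length \<tau>'"
    using G G' by (auto simp: GJBD_sol_def)
  have len: "length \<tau>' = length \<tau>"
    using max[OF sol'] max'[OF sol] by simp
  have As: "\<forall>i\<le>p. As i \<in> carrier_mat n n"
    using A_class by (simp add: in_mat_class_def)
  have span: "mat_poly n Bs q z \<in> span_mats n As p" for z
    unfolding span_eq[symmetric] by (auto simp: mat_poly_def span_mats_def)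
  define X where "X = mat n n (\<lambda>(k,j). x j $ k)"
  have X: "X \<in> carrier_mat n n" by (simp add: X_def)
  obtain Y where Y: "Y \<in> carrier_mat n n" and XY: "X * Y = 1\<^sub>m n" and YX: "Y * X = 1\<^sub>m n"
    using mat_inverse_exists[OF X X_nonsing[folded X_def]] .
  obtain V s where V: "V \<in> carrier_mat n n" and WV: "W * V = 1\<^sub>m n" and VW: "V * W = 1\<^sub>m n"
    and blk: "blocked n (blk_idx \<tau>) s (V * X)"
    using JBD_sol_coloring[OF sol As span eig gm_one] unfolding X_def .
  obtain V' s' where V': "V' \<in> carrier_mat n n" and WV': "W' * V' = 1\<^sub>m n" and VW': "V' * W' = 1\<^sub>m n"
    and blk': "blocked n (blk_idx \<tau>') s' (V' * X)"
    using JBD_sol_coloring[OF sol' As span eig gm_one] unfolding X_def .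
  have W: "W \<in> carrier_mat n n" and W': "W' \<in> carrier_mat n n"
    and part: "is_partition n \<tau>" "is_partition n \<tau>'"
    using sol sol' in_diag_class_carrier by (auto simp: JBD_sol_def)
  note s = coloring_card[OF part(1) blk Y W V X WV VW XY YX]
  note s' = coloring_card[OF part(2) blk' Y W' V' X WV' VW' XY YX]
  define R where "R = (\<lambda>j. (s j, s' j)) ` {..<n}"
  have finR: "finite R" by (simp add: R_def)
  obtain \<tau>'' W'' where "JBD_sol dc n As p \<tau>'' W''" "length \<tau>'' = card R"
    using common_refinement_sol[OF As X Y XY YX sol V WV VW blk sol' V' WV' VW' blk']
    unfolding R_def .
  with max have card_R: "card R \<le> length \<tau>" by metis
  have fst_R: "fst ` R = {..<length \<tau>}" and snd_R: "snd ` R = {..<length \<tau>}"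
    using s(2) s'(2) len by (simp_all add: R_def image_image)
  \<comment> \<open>\<open>R\<close> has at most as many elements as its image under either
    projection, so both projections are injective and \<open>R\<close> is the graph of a bijection
    between the blocks.\<close>
  have "inj_on fst R"
    using card_R finR fst_R card_image_le[OF finR, of fst] by (intro eq_card_imp_inj_on) auto
  then have bij_fst: "bij_betw fst R {..<length \<tau>}"
    using fst_R by (simp add: bij_betw_def)
  have "inj_on snd R"
    using card_R finR snd_R card_image_le[OF finR, of snd] by (intro eq_card_imp_inj_on) auto
  then have bij_snd: "bij_betw snd R {..<length \<tau>}"
    using snd_R by (simp add: bij_betw_def)
  \<comment> \<open>The bijection with graph \<open>R\<close>, extended by the identity as
    \<open>permutes\<close> requires.\<close>
  define \<sigma> where "\<sigma> i = (if i < length \<tau> then snd (inv_into R fst i) else i)" for i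
  have "bij_betw (snd \<circ> inv_into R fst) {..<length \<tau>} {..<length \<tau>}"
    using bij_betw_inv_into[OF bij_fst] bij_snd by (rule bij_betw_trans)
  then have "bij_betw \<sigma> {..<length \<tau>} {..<length \<tau>}"
    by (rule bij_betw_cong[THEN iffD1, rotated]) (simp add: \<sigma>_def)
  then have \<sigma>: "\<sigma> permutes {0..<length \<tau>}"
    unfolding atLeast0LessThan by (rule bij_imp_permutes) (simp add: \<sigma>_def)
  have \<sigma>_s: "\<sigma> (s j) = s' j" and s_lt: "s j < length \<tau>" if "j < n" for j
  proof -
    show lt: "s j < length \<tau>" using s(2) that by auto
    have "(s j, s' j) \<in> R" using that by (auto simp: R_def)
    then have "inv_into R fst (s j) = (s j, s' j)"
      using inv_into_f_f[OF bij_betw_imp_inj_on[OF bij_fst], of "(s j, s' j)"] by simp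
    then show "\<sigma> (s j) = s' j" using lt by (simp add: \<sigma>_def)
  qed
  have sizes: "\<tau>' ! \<sigma> i = \<tau> ! i" if "i < length \<tau>" for i
  proof -
    have "\<sigma> i < length \<tau>'"
      using permutes_in_image[OF \<sigma>, of i] that len by simp
    \<comment> \<open>Block \<open>i\<close> of the first solution and block
      \<open>\<sigma> i\<close> of the second receive the same eigenvectors, whose number is the
      block size.\<close>
    moreover have "{j. j < n \<and> s' j = \<sigma> i} = {j. j < n \<and> s j = i}"
      using \<sigma>_s inj_eq[OF permutes_inj[OF \<sigma>]] by metis
    ultimately show ?thesis
      using s(1)[OF that] s'(1)[of "\<sigma> i"] by simp
  qed
  \<comment> \<open>The change of basis from \<open>W\<close> to \<open>W'\<close>. It passes
    through the eigenvectors as \<open>(V * X) * (Y * W')\<close>, and the support of each factor is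
    known.\<close>
  define Z where "Z = V * W'"
  have Z: "Z \<in> carrier_mat n n" using V W' by (simp add: Z_def)
  have YW': "Y * W' \<in> carrier_mat n n" using Y W' by simp
  note [simp] = assoc_mult_mat[of _ n n _ n _ n] mult_carrier_mat[of _ n n _ n]
  have "(V' * X) * (Y * W') = V' * ((X * Y) * W')"
    using V' X Y W' by (simp del: XY)
  then have i1: "(V' * X) * (Y * W') = 1\<^sub>m n"
    using W' by (simp add: XY VW')
  have i2: "(Y * W') * (V' * X) = 1\<^sub>m n"
    using mat_mult_left_right_inverse[OF blocked_carrier[OF blk'] YW' i1] .
  \<comment> \<open>Relabelling the rows by \<open>\<sigma>\<close> turns the column coloring
    \<open>s\<close> into \<open>s'\<close>, which matches the rows of the second factor.\<close>
  have "blocked n (\<lambda>k. \<sigma> (blk_idx \<tau> k)) s' (V * X)"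
    using blk \<sigma>_s unfolding blocked_def by metis
  from blocked_mult[OF this blocked_inverse[OF blk' YW' i1 i2]]
  have "blocked n (\<lambda>k. \<sigma> (blk_idx \<tau> k)) (blk_idx \<tau>') ((V * X) * (Y * W'))" .
  also have "(V * X) * (Y * W') = V * ((X * Y) * W')"
    using V X Y W' by (simp del: XY)
  also have "\<dots> = Z" using W' by (simp add: XY Z_def)
  finally have Z_blk: "blocked n (\<lambda>k. \<sigma> (blk_idx \<tau> k)) (blk_idx \<tau>') Z" .
  have WZ: "W * Z = W'"
    unfolding Z_def using assoc_mult_mat[OF W V W'] W' by (simp add: WV)
  have "det W' \<noteq> 0"
    using sol' in_diag_class_det_nonzero by (auto simp: JBD_sol_def)
  then have "det Z \<noteq> 0"
    using det_mult[OF W Z] WZ by auto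
  have "equiv_sol n (\<tau>, W) (\<tau>', W * Z)"
  proof (rule equiv_solI[OF _ _ \<sigma> len sizes W Z \<open>det Z \<noteq> 0\<close>])
    show "sum_list \<tau> = n" "sum_list \<tau>' = n"
      using part by (simp_all add: is_partition_def)
    show "Z $$ (k,l) = 0" if "k < n" "l < n" "blk_idx \<tau>' l \<noteq> \<sigma> (blk_idx \<tau> k)" for k l
      using Z_blk that unfolding blocked_def by metis
  qed
  then show "equiv_sol n (\<tau>, W) (\<tau>', W')" by (simp add: WZ)
qed

end
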